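(* Let $\eta\in(0,1/2]$. There is a constant $c>0$ depending only on $\eta$ such that the following holds for all integers $n\ge2$ and $k$ with $\eta\le k/n\le1-\eta$. Let $\mu$ be the uniform distribution on the slice $\binom{[n]}{k}$ and let $U$ be the set of all transpositions $(i\ j)$, $1\le i<j\le n$. For every $f:\binom{[n]}{k}\to\{\pm1\}$: (1) (KKL) $\displaystyle \max_{u\in U}\mathsf{Inf}_{\mu,u}(f)\ge c\,\frac{\log n}{n}\,\mathrm{Var}_\mu(f)$; (2) (Talagrand's $L^1$–$L^2$) with $L_uf(x)=\frac12(f(x^u)-f(x))$, $$c\,\mathrm{Var}_\mu(f)\le\frac1n\sum_{u\in U}\frac{\|L_uf\|_2^2}{1+\log(\|L_uf\|_2/\|L_uf\|_1)}=\frac1n\sum_{u\in U}\frac{\mathsf{Inf}_{\mu,u}(f)}{1+\log(1/\sqrt{\mathsf{Inf}_{\mu,u}(f)})};$$ (3) (Talagrand's variance–surface-area) $\displaystyle \mathsf{SA}_\mu(f)\ge c\,\sqrt n\,\mathrm{Var}_\mu(f)\sqrt{\log\frac{e}{\mathrm{Var}_\mu(f)}}$; (4) (Eldan–Gross) $\displaystyle \mathsf{SA}_\mu(f)\ge c\,\sqrt n\,\mathrm{Var}_\mu(f)\sqrt{\log\left(1+\frac{e}{\mathsf{SqInf}_\mu(f)}\right)}$.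
   Context: $\binom{[n]}{k}$ is the set of $k$-element subsets of $[n]=\{1,\dots,n\}$, on which the symmetric group $S_n$ acts; for a transposition $u$, $x^u=u\cdot x$ is the image of $x$ under $u$ (so $x^u=x$ if $u$ swaps two elements both in $x$ or both outside $x$). $\log$ is natural and $\|g\|_p=(\mathbb{E}_\mu|g|^p)^{1/p}$. For $f:\binom{[n]}{k}\to\{\pm1\}$: $\mathsf{Inf}_{\mu,u}(f)=\Pr_{x\sim\mu}[f(x)\ne f(x^u)]$; $s(f)(x)=\#\{u\in U:f(x^u)\ne f(x)\}$; $\mathsf{SA}_\mu(f)=\mathbb{E}_\mu[\sqrt{s(f)}]$; $\mathsf{SqInf}_\mu(f)=\sum_{u\in U}\mathsf{Inf}_{\mu,u}(f)^2$; $\mathrm{Var}_\mu(f)=\mathbb{E}_\mu[f^2]-(\mathbb{E}_\mu f)^2$. Conventions: summands in (2) with $\mathsf{Inf}_{\mu,u}(f)=0$ are $0$; the right-hand sides of (3),(4) are $0$ if $\mathrm{Var}_\mu(f)=0$. *)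

theory Defs
  imports "HOL-Probability.Probability" "HOL-Combinatorics.Transposition"
begin

definition slice :: "nat \<Rightarrow> nat \<Rightarrow> nat set set" where
  "slice n k = {x. x \<subseteq> {1..n} \<and> card x = k}"

definition unif_slice :: "nat \<Rightarrow> nat \<Rightarrow> nat set pmf" where
  "unif_slice n k = pmf_of_set (slice n k)"

text \<open>Transpositions are permutations of \<^typ>\<open>nat\<close>; such a \<open>u\<close> acts on a set \<open>x\<close> by
  taking the image \<open>u ` x\<close>, which is the \<open>x\<^sup>u\<close> of the mathematical notation.
  Functions on the slice are total functions on \<^typ>\<open>nat set\<close>; their values outside the
  slice are irrelevant, since the slice is invariant under the action and carries the measure.\<close>

definition transpositions :: "nat \<Rightarrow> (nat \<Rightarrow> nat) set" where
  "transpositions n = {Transposition.transpose i j | i j. 1 \<le> i \<and> i < j \<and> j \<le> n}"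

definition Infl :: "nat set pmf \<Rightarrow> (nat \<Rightarrow> nat) \<Rightarrow> (nat set \<Rightarrow> real) \<Rightarrow> real" where
  "Infl \<mu> u f = measure_pmf.prob \<mu> {x. f x \<noteq> f (u ` x)}"

definition sens :: "(nat \<Rightarrow> nat) set \<Rightarrow> (nat set \<Rightarrow> real) \<Rightarrow> nat set \<Rightarrow> nat" where
  "sens U f x = card {u \<in> U. f (u ` x) \<noteq> f x}"

definition SA :: "nat set pmf \<Rightarrow> (nat \<Rightarrow> nat) set \<Rightarrow> (nat set \<Rightarrow> real) \<Rightarrow> real" where
  "SA \<mu> U f = measure_pmf.expectation \<mu> (\<lambda>x. sqrt (real (sens U f x)))"

definition SqInf :: "nat set pmf \<Rightarrow> (nat \<Rightarrow> nat) set \<Rightarrow> (nat set \<Rightarrow> real) \<Rightarrow> real" where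
  "SqInf \<mu> U f = (\<Sum>u\<in>U. (Infl \<mu> u f)\<^sup>2)"

definition Varf :: "nat set pmf \<Rightarrow> (nat set \<Rightarrow> real) \<Rightarrow> real" where
  "Varf \<mu> f = measure_pmf.expectation \<mu> (\<lambda>x. (f x)\<^sup>2) - (measure_pmf.expectation \<mu> f)\<^sup>2"

definition Ldiff :: "(nat \<Rightarrow> nat) \<Rightarrow> (nat set \<Rightarrow> real) \<Rightarrow> nat set \<Rightarrow> real" where
  "Ldiff u f x = (f (u ` x) - f x) / 2"

definition pnorm :: "nat set pmf \<Rightarrow> real \<Rightarrow> (nat set \<Rightarrow> real) \<Rightarrow> real" where
  "pnorm \<mu> p g = (measure_pmf.expectation \<mu> (\<lambda>x. \<bar>g x\<bar> powr p)) powr (1 / p)"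

end

theory Submission
  imports Defs
begin

text \<open>
  The proof runs the lazy random walk \<open>R\<close> on the slice: with probability \<open>1/2\<close> stay put, otherwise apply
  a uniformly random transposition. Two features of this walk carry everything.

  \<^item> Conjugating a transposition by a transposition gives a transposition, so \<open>R\<close> commutes with the
    action of each single \<open>u\<close> and hence with each discrete derivative
    \<open>L\<^sub>u g = (g \<circ> u - g) / 2\<close> (lemma \<open>half_diff_step\<close>).

  \<^item> The walk satisfies a logarithmic Sobolev inequality whose constant is of order \<open>1/n\<close> when \<open>k/n\<close>
    stays away from \<open>0\<close> and \<open>1\<close> (lemma \<open>slice_log_sobolev\<close>). It is proved by revealing one
    element of the larger of the two classes \<open>x\<close> and \<open>V - x\<close>: the entropy splits into the
    entropies of the smaller slices and the entropy of the revealed element, and the latter is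
    controlled because the density of the revealed element is at most twice its mean.

  Applied to the iterates \<open>R\<^sup>s g\<close>, the logarithmic Sobolev inequality becomes a difference inequality
  for \<open>E (R\<^sup>s g)\<^sup>2\<close> alone, because \<open>E |R\<^sup>s g|\<close> does not increase. Solving it shows that
  \<open>E (R\<^sup>s g)\<^sup>2 \<le> t\<^bsup>1 + \<kappa>s/2\<^esup>\<close> for every \<open>g\<close> with values in \<open>{-1, 0, 1}\<close> and
  \<open>E |g| = t\<close>, where \<open>\<kappa>\<close> is of order \<open>1/n\<close> and \<open>\<kappa>s \<le> 1\<close> (lemma \<open>small_set_expansion\<close>). This replaces
  hypercontractivity.

  For the \<open>L\<^sup>1\<close>-\<open>L\<^sup>2\<close> inequality, about \<open>1/\<kappa>\<close> steps of the walk destroy a constant fraction of the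
  variance, and the loss in step \<open>s\<close> is at most twice the average over \<open>u\<close> of
  \<open>E (L\<^sub>u R\<^sup>s f)\<^sup>2 = E (R\<^sup>s L\<^sub>u f)\<^sup>2\<close>. Small-set expansion turns the sum over \<open>s\<close> into a geometric
  series, whose value is the logarithmic gain. The KKL bound follows: either some influence
  is at least \<open>1/\<surd>n\<close>, or all denominators in the \<open>L\<^sup>1\<close>-\<open>L\<^sup>2\<close> inequality are at least of order \<open>log n\<close>.

  For the surface-area bound, commutation gives the reverse Poincare inequality
  \<open>|\<nabla>R\<^sup>s g|\<^sup>2 \<le> 1/(s+1)\<close> for \<open>|g| \<le> 1\<close>, where \<open>|\<nabla>g|\<^sup>2\<close> is the average of
  \<open>(L\<^sub>u g)\<^sup>2\<close> over \<open>u\<close>; and by duality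
  \<open>E f (f - R\<^sup>N f) \<le> 2 \<surd>N E |\<nabla>f|\<close> (lemma \<open>displacement_le_gradient\<close>). By small-set
  expansion, a walk started in a set of measure \<open>t \<le> 1/2\<close> has left it with probability bounded below
  after \<open>N\<close> of order \<open>n / log(1/t)\<close> steps.
  Finally the \<open>L\<^sup>1\<close>-\<open>L\<^sup>2\<close> inequality and the Cauchy-Schwarz inequality show that \<open>SqInf\<close> is at least a constant times the
  square of the variance, so that the Eldan-Gross bound is a consequence of the surface-area bound.
\<close>

section \<open>The logarithmic Sobolev inequality on slices\<close>

definition ksets :: "'a set \<Rightarrow> nat \<Rightarrow> 'a set set" where
  "ksets V k = {x. x \<subseteq> V \<and> card x = k}"

text \<open>
  Entropy with respect to counting measure: \<open>card S\<close> times the entropy of \<open>h\<close> under the uniform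
  distribution on \<open>S\<close>. Without the normalisation the entropies of slices of different sizes can be
  added directly.
\<close>

definition ent :: "'b set \<Rightarrow> ('b \<Rightarrow> real) \<Rightarrow> real" where
  "ent S h = (\<Sum>x\<in>S. h x * ln (h x)) - (\<Sum>x\<in>S. h x) * ln ((\<Sum>x\<in>S. h x) / card S)"

text \<open>
  The Dirichlet form of the exchange dynamics, again with respect to counting measure. Only the
  transpositions that move \<open>x\<close> occur, one for each element \<open>a\<close> of \<open>x\<close> and each \<open>b\<close> outside.
\<close>

definition flow :: "'a set \<Rightarrow> nat \<Rightarrow> ('a set \<Rightarrow> real) \<Rightarrow> real" where
  "flow V k g = (\<Sum>x\<in>ksets V k. \<Sum>a\<in>x. \<Sum>b\<in>V - x. (g x - g (Transposition.transpose a b ` x))\<^sup>2)"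

lemma finite_ksets [simp]: "finite V \<Longrightarrow> finite (ksets V k)"
  unfolding ksets_def by simp

lemma card_ksets: "finite V \<Longrightarrow> card (ksets V k) = card V choose k"
  unfolding ksets_def by (rule n_subsets)

lemma flow_nonneg: "0 \<le> flow V k g"
  unfolding flow_def by (intro sum_nonneg) auto

lemma transpose_image_involutory [simp]:
  "Transposition.transpose a b ` Transposition.transpose a b ` x = x"
  by (auto simp: image_image)

lemma transpose_image_ksets:
  assumes "x \<in> ksets V k" "a \<in> V" "b \<in> V"
  shows "Transposition.transpose a b ` x \<in> ksets V k"
proof -
  have "card (Transposition.transpose a b ` x) = card x"
    by (rule card_image) (rule inj_on_subset[OF inj_transpose], simp)
  moreover have "Transposition.transpose a b ` x \<subseteq> V"
    using assms by (auto simp: ksets_def Transposition.transpose_def)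
  ultimately show ?thesis using assms(1) by (simp add: ksets_def)
qed

text \<open>
  Double counting of the pairs (set, element of the set): choosing a \<open>Suc k\<close>-set and then one of its
  elements amounts to choosing the element first and completing it by a \<open>k\<close>-set.
\<close>

lemma sum_ksets_Suc:
  assumes "finite V"
  shows "(\<Sum>x\<in>ksets V (Suc k). \<Sum>a\<in>x. F a x)
       = (\<Sum>a\<in>V. \<Sum>y\<in>ksets (V - {a}) k. F a (insert a y))"
proof -
  have fin: "finite x" if "x \<in> ksets V j" for x j
    using that assms by (auto simp: ksets_def intro: finite_subset)
  have "(\<Sum>x\<in>ksets V (Suc k). \<Sum>a\<in>x. F a x)
      = (\<Sum>(x,a)\<in>Sigma (ksets V (Suc k)) (\<lambda>x. x). F a x)"
    using assms fin by (subst sum.Sigma) auto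
  also have "\<dots> = (\<Sum>(a,y)\<in>Sigma V (\<lambda>a. ksets (V - {a}) k). F a (insert a y))"
  proof (rule sum.reindex_bij_witness[where i = "\<lambda>(a,y). (insert a y, a)" and j = "\<lambda>(x,a). (a, x - {a})"], goal_cases)
    case (1 p)
    then show ?case by (auto simp: insert_absorb)
  next
    case (2 p)
    then obtain x a where p: "p = (x,a)" "x \<in> ksets V (Suc k)" "a \<in> x" by auto
    then have "finite x" "x \<subseteq> V" "card x = Suc k" using fin[of x] by (auto simp: ksets_def)
    with p show ?case by (auto simp: ksets_def)
  next
    case (3 p)
    then obtain a y where p: "p = (a,y)" "y \<subseteq> V - {a}" by (auto simp: ksets_def)
    then show ?case by auto
  next
    case (4 p)
    then obtain a y where p: "p = (a,y)" "a \<in> V" "y \<subseteq> V - {a}" "card y = k" by (auto simp: ksets_def)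
    then have "finite y" "a \<notin> y" using assms finite_subset[of y "V - {a}"] by auto
    with p show ?case by (auto simp: ksets_def)
  next
    case (5 p)
    then show ?case by (auto simp: insert_absorb)
  qed
  also have "\<dots> = (\<Sum>a\<in>V. \<Sum>y\<in>ksets (V - {a}) k. F a (insert a y))"
    using assms by (subst sum.Sigma) auto
  finally show ?thesis .
qed

lemma transpose_image_insert:
  assumes "a \<noteq> c" "a \<noteq> d"
  shows "Transposition.transpose c d ` insert a y = insert a (Transposition.transpose c d ` y)"
  using assms by simp

text \<open>
  An exchange \<open>(c, d)\<close> at \<open>x\<close> survives in the slice that fixes \<open>a \<in> x\<close> unless \<open>a = c\<close>, so each
  exchange is counted for \<open>k\<close> of the \<open>k + 1\<close> elements of \<open>x\<close>.
\<close>

lemma sum_flow_link: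
  assumes "finite V"
  shows "(\<Sum>a\<in>V. flow (V - {a}) k (\<lambda>y. g (insert a y))) = real k * flow V (Suc k) g"
proof -
  \<comment> \<open>the part of the flow at \<open>x\<close> that exchanges the element \<open>c\<close>\<close>
  define W where "W x c = (\<Sum>d\<in>V - x. (g x - g (Transposition.transpose c d ` x))\<^sup>2)" for x c
  have "flow (V - {a}) k (\<lambda>y. g (insert a y))
      = (\<Sum>y\<in>ksets (V - {a}) k. \<Sum>c\<in>insert a y - {a}. W (insert a y) c)" if "a \<in> V" for a
    unfolding flow_def
  proof (rule sum.cong[OF refl])
    fix y assume "y \<in> ksets (V - {a}) k"
    then have "a \<notin> y" "y \<subseteq> V" by (auto simp: ksets_def)
    then have eqs: "insert a y - {a} = y" "V - insert a y = V - {a} - y" by auto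
    have t: "insert a (Transposition.transpose c d ` y) = Transposition.transpose c d ` insert a y"
      if "c \<in> y" "d \<in> V - {a} - y" for c d
      by (rule transpose_image_insert[symmetric]) (use that \<open>a \<notin> y\<close> in auto)
    show "(\<Sum>c\<in>y. \<Sum>d\<in>V - {a} - y.
        (g (insert a y) - g (insert a (Transposition.transpose c d ` y)))\<^sup>2) =
        (\<Sum>c\<in>insert a y - {a}. W (insert a y) c)"
      unfolding W_def eqs by (intro sum.cong refl) (simp only: t)
  qed
  then have "(\<Sum>a\<in>V. flow (V - {a}) k (\<lambda>y. g (insert a y)))
      = (\<Sum>a\<in>V. \<Sum>y\<in>ksets (V - {a}) k. \<Sum>c\<in>insert a y - {a}. W (insert a y) c)" by simp
  also have "\<dots> = (\<Sum>x\<in>ksets V (Suc k). \<Sum>a\<in>x. \<Sum>c\<in>x - {a}. W x c)"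
    by (rule sum_ksets_Suc[OF assms, symmetric, where F = "\<lambda>a x. \<Sum>c\<in>x - {a}. W x c"])
  also have "\<dots> = (\<Sum>x\<in>ksets V (Suc k). real k * (\<Sum>c\<in>x. W x c))"
  proof (rule sum.cong[OF refl])
    fix x assume "x \<in> ksets V (Suc k)"
    then have x: "finite x" "card x = Suc k" using assms by (auto simp: ksets_def intro: finite_subset)
    have "(\<Sum>a\<in>x. \<Sum>c\<in>x - {a}. W x c) = (\<Sum>a\<in>x. (\<Sum>c\<in>x. W x c) - W x a)"
      using x by (intro sum.cong) (auto simp: sum_diff1)
    also have "\<dots> = real k * (\<Sum>c\<in>x. W x c)"
      using x by (simp add: sum_subtractf algebra_simps)
    finally show "(\<Sum>a\<in>x. \<Sum>c\<in>x - {a}. W x c) = real k * (\<Sum>c\<in>x. W x c)" .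
  qed
  also have "\<dots> = real k * flow V (Suc k) g"
    by (simp add: flow_def W_def sum_distrib_left)
  finally show ?thesis .
qed

text \<open>
  Complementation identifies the slices of sizes \<open>k\<close> and \<open>l\<close> and respects exchanges. With
  the next lemma it allows the larger class to be the one whose elements are revealed.
\<close>

lemma flow_complement:
  assumes "finite V" "card V = k + l"
  shows "flow V k (\<lambda>x. g (V - x)) = flow V l g"
proof -
  have "flow V k (\<lambda>x. g (V - x)) = (\<Sum>x\<in>ksets V k. \<Sum>b\<in>V - x. \<Sum>a\<in>x.
     (g (V - x) - g (V - Transposition.transpose a b ` x))\<^sup>2)"
    unfolding flow_def by (intro sum.cong sum.swap refl)
  also have "\<dots> = (\<Sum>x\<in>ksets V k. \<Sum>b\<in>V - x. \<Sum>a\<in>V - (V - x).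
     (g (V - x) - g (Transposition.transpose b a ` (V - x)))\<^sup>2)"
  proof (intro sum.cong refl)
    fix x b a
    assume x: "x \<in> ksets V k" and b: "b \<in> V - x" and a: "a \<in> V - (V - x)"
    have tV: "Transposition.transpose b a ` V = V"
      using a b by (intro transpose_image_eq) auto
    have "Transposition.transpose b a ` (V - x) = Transposition.transpose b a ` V - Transposition.transpose b a ` x"
      by (rule image_set_diff) simp
    then show "(g (V - x) - g (V - Transposition.transpose a b ` x))\<^sup>2 =
           (g (V - x) - g (Transposition.transpose b a ` (V - x)))\<^sup>2"
      using tV by (simp add: transpose_commute)
  qed (auto simp: ksets_def)
  also have "\<dots> = flow V l g"
    unfolding flow_def
    by (rule sum.reindex_bij_witness[where i = "\<lambda>x. V - x" and j = "\<lambda>x. V - x"])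
      (use assms in \<open>auto simp: ksets_def card_Diff_subset finite_subset double_diff\<close>)
  finally show ?thesis .
qed

lemma ent_complement:
  assumes "finite V" "card V = k + l"
  shows "ent (ksets V k) (\<lambda>x. h (V - x)) = ent (ksets V l) h"
proof -
  have *: "(\<Sum>x\<in>ksets V k. G (V - x)) = (\<Sum>x\<in>ksets V l. G x)" for G :: "'a set \<Rightarrow> real"
    by (rule sum.reindex_bij_witness[where i = "\<lambda>x. V - x" and j = "\<lambda>x. V - x"])
      (use assms in \<open>auto simp: ksets_def card_Diff_subset finite_subset double_diff\<close>)
  have "card (ksets V k) = card (ksets V l)"
    using assms by (simp add: card_ksets) (metis add_diff_cancel_left' binomial_symmetric le_add1)
  then show ?thesis
    unfolding ent_def using *[of "\<lambda>x. h x * ln (h x)"] *[of h] by simp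
qed

text \<open>
  On a complete graph the logarithmic Sobolev constant degenerates like the logarithm of the number
  of vertices, and it does so only through densities with high peaks. For a density \<open>s\<^sup>2 = p/m\<close> with
  \<open>s\<^sup>2 \<le> 2\<close> the elementary bound \<open>ln s \<le> s - 1\<close> gives
  \<open>s\<^sup>2 ln s\<^sup>2 - s\<^sup>2 + 1 \<le> (s - 1)\<^sup>2 (2s + 1)\<close>, so entropy is at most a constant times the variance of \<open>s\<close>.
\<close>

lemma entropy_le_sqrt_differences:
  fixes p :: "'a \<Rightarrow> real"
  assumes "finite V" and p: "\<And>a. a \<in> V \<Longrightarrow> 0 \<le> p a" "\<And>a. a \<in> V \<Longrightarrow> p a \<le> 2 * m"
    and m: "m = (\<Sum>a\<in>V. p a) / card V"
  shows "(\<Sum>a\<in>V. p a * ln (p a / m)) \<le> 4 / card V * (\<Sum>a\<in>V. \<Sum>b\<in>V. (sqrt (p a) - sqrt (p b))\<^sup>2)"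
proof (cases "m = 0")
  case True
  then show ?thesis by (auto intro!: sum_nonneg divide_nonneg_nonneg)
next
  case False
  then have n: "card V > 0" using m by (cases "card V = 0") auto
  have m0: "m > 0" using False m p by (metis divide_nonneg_nonneg of_nat_0_le_iff order_less_le sum_nonneg)
  define s where "s a = sqrt (p a / m)" for a
  have s: "0 \<le> s a" "s a \<le> 3/2" "p a = m * (s a)\<^sup>2" if "a \<in> V" for a
  proof -
    show "0 \<le> s a" using p m0 that by (simp add: s_def)
    have "p a / m \<le> (3/2)\<^sup>2" using p[OF that] m0 by (simp add: divide_simps power2_eq_square)
    then show "s a \<le> 3/2" unfolding s_def by (rule real_le_lsqrt[rotated]) simp
    show "p a = m * (s a)\<^sup>2" using p[OF that] m0 by (simp add: s_def)
  qed
  have pt: "t\<^sup>2 * ln (t\<^sup>2) \<le> t\<^sup>2 - 1 + 4 * (t - 1)\<^sup>2" if "0 \<le> t" "t \<le> 3/2" for t :: real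
  proof (cases "t = 0")
    case False
    then have "ln (t\<^sup>2) \<le> 2 * (t - 1)"
      using that ln_le_minus_one[of t] by (simp add: ln_realpow)
    then have "t\<^sup>2 * ln (t\<^sup>2) \<le> t\<^sup>2 * (2 * (t - 1))" by (intro mult_left_mono) auto
    also have "\<dots> = t\<^sup>2 - 1 + (t - 1)\<^sup>2 * (2 * t + 1)" by (simp add: power2_eq_square algebra_simps)
    also have "(t - 1)\<^sup>2 * (2 * t + 1) \<le> (t - 1)\<^sup>2 * 4" using that by (intro mult_left_mono) auto
    finally show ?thesis by simp
  qed simp
  define n' where "n' = real (card V)"
  define S where "S = (\<Sum>a\<in>V. s a)"
  have sum1: "(\<Sum>a\<in>V. (s a)\<^sup>2) = n'"
  proof -
    have "m * (\<Sum>a\<in>V. (s a)\<^sup>2) = (\<Sum>a\<in>V. p a)" using s by (simp add: sum_distrib_left)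
    also have "\<dots> = m * n'" using m n by (simp add: n'_def)
    finally show ?thesis using m0 by simp
  qed
  have S0: "0 \<le> S" unfolding S_def using s by (intro sum_nonneg) auto
  have pairs: "(\<Sum>a\<in>V. \<Sum>b\<in>V. (s a - s b)\<^sup>2) = 2 * (n' * n' - S\<^sup>2)"
  proof -
    have "(\<Sum>a\<in>V. \<Sum>b\<in>V. (s a - s b)\<^sup>2)
        = (\<Sum>a\<in>V. n' * (s a)\<^sup>2 + n' - 2 * s a * S)"
      by (intro sum.cong refl)
        (simp add: power2_diff sum.distrib sum_subtractf sum1 S_def sum_distrib_left n'_def)
    also have "\<dots> = n' * n' + n' * n' - 2 * S * S"
      by (simp add: sum.distrib sum_subtractf sum_distrib_left[symmetric] sum1)
        (simp add: n'_def S_def sum_distrib_right[symmetric] sum_distrib_left[symmetric] mult.assoc)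
    finally show ?thesis by (simp add: power2_eq_square)
  qed
  have "0 \<le> (\<Sum>a\<in>V. \<Sum>b\<in>V. (s a - s b)\<^sup>2)" by (intro sum_nonneg) auto
  then have Sn: "S \<le> n'" using pairs S0 by (simp add: power2_eq_square[symmetric] n'_def)
  have n0: "n' > 0" using n by (simp add: n'_def)
  have "(\<Sum>a\<in>V. p a * ln (p a / m)) = m * (\<Sum>a\<in>V. (s a)\<^sup>2 * ln ((s a)\<^sup>2))"
    using s(3) m0 by (simp add: sum_distrib_left mult.assoc)
  also have "\<dots> \<le> m * (\<Sum>a\<in>V. (s a)\<^sup>2 - 1 + 4 * (s a - 1)\<^sup>2)"
    using s pt m0 by (intro mult_left_mono sum_mono) auto
  also have "(\<Sum>a\<in>V. (s a)\<^sup>2 - 1 + 4 * (s a - 1)\<^sup>2) = 8 * (n' - S)"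
    by (simp add: power2_diff sum.distrib sum_subtractf sum_distrib_left[symmetric] sum1)
      (simp add: n'_def S_def sum_distrib_left)
  also have "m * (8 * (n' - S)) \<le> m * (8 * ((n' * n' - S\<^sup>2) / n'))"
  proof -
    have "S\<^sup>2 \<le> S * n'" using Sn S0 by (simp add: power2_eq_square mult_left_mono)
    then have "n' - S \<le> (n' * n' - S\<^sup>2) / n'" using n0 by (simp add: field_simps)
    then show ?thesis using m0 by (intro mult_left_mono) auto
  qed
  also have "\<dots> = 4 / n' * (m * (\<Sum>a\<in>V. \<Sum>b\<in>V. (s a - s b)\<^sup>2))"
    using n0 by (simp add: pairs)
  also have "m * (\<Sum>a\<in>V. \<Sum>b\<in>V. (s a - s b)\<^sup>2) = (\<Sum>a\<in>V. \<Sum>b\<in>V. (sqrt (p a) - sqrt (p b))\<^sup>2)"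
  proof -
    have "sqrt (p a) = sqrt m * s a" if "a \<in> V" for a
      using m0 by (simp add: s_def real_sqrt_divide)
    then have "(sqrt (p a) - sqrt (p b))\<^sup>2 = m * (s a - s b)\<^sup>2" if "a \<in> V" "b \<in> V" for a b
      using that m0 by (simp add: right_diff_distrib[symmetric] power_mult_distrib)
    then show ?thesis by (simp add: sum_distrib_left)
  qed
  finally show ?thesis by (simp add: n'_def)
qed


text \<open>
  The transposition of \<open>a\<close> and \<open>b\<close> maps the sets through \<open>a\<close> bijectively to the sets through
  \<open>b\<close> and fixes those containing both. So \<open>\<surd>H a\<close> and \<open>\<surd>H b\<close> are the Euclidean norms of \<open>g\<close> and of
  its translate on one and the same index set, and the triangle inequality bounds their difference
  by exchanges of \<open>a\<close> for \<open>b\<close>.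
\<close>

lemma link_norm_differences:
  fixes g :: "'a set \<Rightarrow> real" and k :: nat
  assumes V: "finite V"
  defines "H \<equiv> \<lambda>a. \<Sum>x\<in>{x \<in> ksets V k. a \<in> x}. (g x)\<^sup>2"
  shows "(\<Sum>a\<in>V. \<Sum>b\<in>V. (sqrt (H a) - sqrt (H b))\<^sup>2) \<le> flow V k g"
proof -
  let ?t = Transposition.transpose
  define S where "S a = {x \<in> ksets V k. a \<in> x}" for a
  have fin [simp]: "finite (S a)" for a using V by (simp add: S_def)
  have pair: "(sqrt (H a) - sqrt (H b))\<^sup>2 \<le> (\<Sum>x\<in>S a. if b \<in> x then 0 else (g x - g (?t a b ` x))\<^sup>2)"
    if "a \<in> V" "b \<in> V" for a b
  proof (cases "a = b")
    case True
    then show ?thesis by (auto intro!: sum_nonneg)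
  next
    case False
    define t where "t x = (if b \<in> x then x else ?t a b ` x)" for x
    have tid: "?t a b ` x = x" if "a \<in> x" "b \<in> x" for x using that by (intro transpose_image_eq) auto
    have Hb: "H b = (\<Sum>x\<in>S a. (g (t x))\<^sup>2)"
    proof -
      have "H b = (\<Sum>x\<in>S b. (g x)\<^sup>2)" by (simp add: H_def S_def)
      also have "\<dots> = (\<Sum>x\<in>S a. (g (?t a b ` x))\<^sup>2)"
      proof (rule sum.reindex_bij_witness[where i = "\<lambda>x. ?t a b ` x" and j = "\<lambda>x. ?t a b ` x"])
        fix x assume "x \<in> S b"
        then show "?t a b ` x \<in> S a"
          using transpose_image_ksets[of x V k a b] \<open>a \<in> V\<close> \<open>b \<in> V\<close>
          by (auto simp: S_def image_iff intro!: bexI[of _ b])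
      next
        fix x assume "x \<in> S a"
        then show "?t a b ` x \<in> S b"
          using transpose_image_ksets[of x V k a b] \<open>a \<in> V\<close> \<open>b \<in> V\<close>
          by (auto simp: S_def image_iff intro!: bexI[of _ a])
      qed simp_all
      also have "\<dots> = (\<Sum>x\<in>S a. (g (t x))\<^sup>2)"
        by (intro sum.cong refl) (auto simp: t_def S_def tid)
      finally show ?thesis .
    qed
    have Ha: "H a = (\<Sum>x\<in>S a. (g x)\<^sup>2)" by (simp add: H_def S_def)
    have tri: "L2_set p (S a) \<le> L2_set q (S a) + L2_set (\<lambda>x. p x - q x) (S a)" for p q
      using L2_set_triangle_ineq[of q "\<lambda>x. p x - q x" "S a"] by simp
    have sym: "L2_set (\<lambda>x. g (t x) - g x) (S a) = L2_set (\<lambda>x. g x - g (t x)) (S a)"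
      by (simp add: L2_set_def power2_commute)
    have "\<bar>sqrt (H a) - sqrt (H b)\<bar> \<le> L2_set (\<lambda>x. g x - g (t x)) (S a)"
      using tri[of g "\<lambda>x. g (t x)"] tri[of "\<lambda>x. g (t x)" g] sym
      by (simp add: Ha Hb L2_set_def[of g] L2_set_def[of "\<lambda>x. g (t x)"] abs_le_iff)
    then have "(sqrt (H a) - sqrt (H b))\<^sup>2 \<le> (L2_set (\<lambda>x. g x - g (t x)) (S a))\<^sup>2"
      by (rule power2_le_iff_abs_le[THEN iffD2, rotated]) simp
    also have "\<dots> = (\<Sum>x\<in>S a. (g x - g (t x))\<^sup>2)"
      by (simp add: L2_set_def sum_nonneg)
    also have "\<dots> = (\<Sum>x\<in>S a. if b \<in> x then 0 else (g x - g (?t a b ` x))\<^sup>2)"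
      by (intro sum.cong refl) (auto simp: t_def)
    finally show ?thesis .
  qed
  have "(\<Sum>a\<in>V. \<Sum>b\<in>V. (sqrt (H a) - sqrt (H b))\<^sup>2)
      \<le> (\<Sum>a\<in>V. \<Sum>b\<in>V. \<Sum>x\<in>S a. if b \<in> x then 0 else (g x - g (?t a b ` x))\<^sup>2)"
    by (intro sum_mono pair)
  also have "\<dots> = (\<Sum>a\<in>V. \<Sum>x\<in>S a. \<Sum>b\<in>V. if b \<in> x then 0 else (g x - g (?t a b ` x))\<^sup>2)"
    by (intro sum.cong sum.swap refl)
  also have "\<dots> = (\<Sum>a\<in>V. \<Sum>x\<in>S a. \<Sum>b\<in>V - x. (g x - g (?t a b ` x))\<^sup>2)"
    using V by (intro sum.cong refl sum.mono_neutral_cong_right) auto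
  also have "\<dots> = (\<Sum>(a,x)\<in>Sigma V S. \<Sum>b\<in>V - x. (g x - g (?t a b ` x))\<^sup>2)"
    using V by (subst sum.Sigma) auto
  also have "\<dots> = (\<Sum>(x,a)\<in>Sigma (ksets V k) (\<lambda>x. x). \<Sum>b\<in>V - x. (g x - g (?t a b ` x))\<^sup>2)"
    by (rule sum.reindex_bij_witness[where i = "\<lambda>(x,a). (a,x)" and j = "\<lambda>(a,x). (x,a)"])
      (auto simp: S_def ksets_def)
  also have "\<dots> = flow V k g"
    unfolding flow_def using V by (subst sum.Sigma) (auto simp: ksets_def intro: finite_subset)
  finally show ?thesis .
qed

text \<open>
  Reveal a uniformly random element \<open>a\<close> of \<open>x\<close>. The entropy of \<open>h\<close> splits into the entropies on
  the slices of sets through \<open>a\<close> and the entropy of the law of the revealed element, whose density is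
  proportional to \<open>H\<close>. In counting measure every \<open>x\<close> contributes once for each of its \<open>Suc k\<close>
  elements.
\<close>

lemma ent_chain_rule:
  fixes h :: "'a set \<Rightarrow> real" and k l :: nat
  assumes V: "finite V" "card V = Suc k + l" and h: "\<And>x. 0 \<le> h x"
  defines "H \<equiv> \<lambda>a. \<Sum>x\<in>{x \<in> ksets V (Suc k). a \<in> x}. h x"
  defines "m \<equiv> (\<Sum>a\<in>V. H a) / card V"
  shows "real (Suc k) * ent (ksets V (Suc k)) h
       = (\<Sum>a\<in>V. ent (ksets (V - {a}) k) (\<lambda>y. h (insert a y))) + (\<Sum>a\<in>V. H a * ln (H a / m))"
proof -
  let ?K = "real (Suc k)"
  define n where "n = real (card V)"
  define M where "M = real (card (ksets V (Suc k)))"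
  define L where "L = real ((card V - 1) choose k)"
  define T where "T = (\<Sum>x\<in>ksets V (Suc k). h x)"
  have fink: "finite x" "card x = Suc k" if "x \<in> ksets V (Suc k)" for x
    using that V by (auto simp: ksets_def intro: finite_subset)
  have link: "(\<Sum>a\<in>V. \<Sum>y\<in>ksets (V - {a}) k. G (insert a y)) = ?K * (\<Sum>x\<in>ksets V (Suc k). G x)"
    for G :: "'a set \<Rightarrow> real"
  proof -
    have "(\<Sum>a\<in>V. \<Sum>y\<in>ksets (V - {a}) k. G (insert a y)) = (\<Sum>x\<in>ksets V (Suc k). \<Sum>a\<in>x. G x)"
      using sum_ksets_Suc[OF V(1), where F = "\<lambda>a x. G x"] by simp
    also have "\<dots> = (\<Sum>x\<in>ksets V (Suc k). ?K * G x)"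
      using fink by (intro sum.cong) auto
    finally show ?thesis by (simp add: sum_distrib_left)
  qed
  have Hy: "H a = (\<Sum>y\<in>ksets (V - {a}) k. h (insert a y))" if "a \<in> V" for a
    unfolding H_def
  proof (rule sum.reindex_bij_witness[where i = "insert a" and j = "\<lambda>x. x - {a}"], goal_cases)
    case (2 x)
    then have x: "x \<in> ksets V (Suc k)" "a \<in> x" by auto
    then have "finite x" "x \<subseteq> V" "card x = Suc k" using fink[OF x(1)] by (simp_all add: ksets_def)
    with x show ?case by (auto simp: ksets_def)
  next
    case (3 y)
    then have "a \<notin> y" "y \<subseteq> V" by (auto simp: ksets_def)
    then show ?case by simp
  next
    case (4 y)
    then have "a \<notin> y" "y \<subseteq> V" "card y = k" "finite y" using V(1) finite_subset[of y V] by (auto simp: ksets_def)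
    then show ?case using \<open>a \<in> V\<close> by (simp add: ksets_def)
  qed (auto simp: insert_absorb)
  have n0: "n > 0" using V by (simp add: n_def)
  have M0: "M > 0" using V by (simp add: M_def card_ksets zero_less_binomial_iff del: binomial_Suc_Suc)
  have L0: "L > 0" using V by (simp add: L_def zero_less_binomial_iff)
  have T0: "T \<ge> 0" unfolding T_def using h by (intro sum_nonneg)
  have sumH: "(\<Sum>a\<in>V. H a) = ?K * T" using link[of h] Hy by (simp add: T_def)
  have m: "m = ?K * T / n" by (simp add: m_def sumH n_def)
  \<comment> \<open>\<open>L\<close> is the size of each slice of sets through a fixed element, \<open>M\<close> that of the whole slice\<close>
  have nLM: "n * L = ?K * M"
  proof -
    have "card V * ((card V - 1) choose k) = Suc k * (card V choose Suc k)"
      using Suc_times_binomial_eq[of "card V - 1" k] V(2) by (simp only: mult.commute) simp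
    then show ?thesis
      unfolding n_def L_def M_def card_ksets[OF V(1)] of_nat_mult[symmetric] by (simp only:)
  qed
  have cardL: "real (card (ksets (V - {a}) k)) = L" if "a \<in> V" for a
    using that V by (simp add: L_def card_ksets)
  have H0: "0 \<le> H a" for a unfolding H_def using h by (intro sum_nonneg)
  have HT: "H a \<le> T" for a unfolding H_def T_def using h V by (intro sum_mono2) auto
  have "(\<Sum>a\<in>V. ent (ksets (V - {a}) k) (\<lambda>y. h (insert a y)))
     = (\<Sum>a\<in>V. (\<Sum>y\<in>ksets (V - {a}) k. h (insert a y) * ln (h (insert a y))) - H a * ln (H a / L))"
    by (intro sum.cong refl) (simp add: ent_def Hy cardL)
  also have "\<dots> = ?K * (\<Sum>x\<in>ksets V (Suc k). h x * ln (h x)) - (\<Sum>a\<in>V. H a * ln (H a / L))"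
    by (simp only: sum_subtractf link[of "\<lambda>x. h x * ln (h x)"])
  also have "(\<Sum>a\<in>V. H a * ln (H a / L)) = (\<Sum>a\<in>V. H a * ln (H a / m) + H a * ln (T / M))"
  proof (rule sum.cong[OF refl])
    fix a
    show "H a * ln (H a / L) = H a * ln (H a / m) + H a * ln (T / M)"
    proof (cases "H a = 0")
      case False
      then have pos: "H a > 0" "T > 0" using H0[of a] HT[of a] by auto
      have "m > 0" using pos n0 by (simp add: m)
      have "m * M = T * (?K * M) / n" by (simp add: m)
      also have "\<dots> = T * (n * L) / n" by (simp only: nLM)
      also have "\<dots> = T * L" using n0 by simp
      finally have "m * M = T * L" .
      then have "H a / L = (H a / m) * (T / M)" using pos L0 M0 \<open>m > 0\<close> by (simp add: field_simps)
      then have "ln (H a / L) = ln (H a / m) + ln (T / M)"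
        using pos M0 \<open>m > 0\<close> ln_mult[of "H a / m" "T / M"] by auto
      then show ?thesis by (simp add: algebra_simps)
    qed simp
  qed
  also have "\<dots> = (\<Sum>a\<in>V. H a * ln (H a / m)) + ?K * T * ln (T / M)"
    by (simp only: sum.distrib sum_distrib_right[symmetric] sumH)
  finally show ?thesis
    by (simp add: ent_def T_def[symmetric] M_def[symmetric] algebra_simps)
qed

text \<open>
  Induction on the size of the ground set. If \<open>k \<ge> l\<close>, then \<open>H a\<close> is at most the full sum, which is
  \<open>n/k \<le> 2\<close> times the mean of \<open>H\<close>; the chain rule and the two preceding bounds then yield, with
  \<open>G(k,l) = k l \<tau>\<close> for the constant \<open>\<tau>\<close> of the inequality, the recursion
  \<open>G(k,l) \<le> G(k-1,l) + 4l/n\<close>. Its increments never exceed \<open>4\<close>, whence \<open>G(k,l) \<le> 4(k + l)\<close>. Always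
  revealing the larger class is what keeps the constant in the recursion universal. If \<open>k = 0\<close> or \<open>l = 0\<close> the
  quotient is \<open>0\<close> by convention, and so is the entropy on a slice with one element.
\<close>

lemma slice_log_sobolev:
  assumes "finite V" "card V = k + l"
  shows "ent (ksets V k) (\<lambda>x. (g x)\<^sup>2) \<le> 4 * (k + l) / (k * l) * flow V k g"
  using assms
proof (induction "card V" arbitrary: V k l g rule: less_induct)
  case less
  have ge: "ent (ksets V k) (\<lambda>x. (g x)\<^sup>2) \<le> 4 * (k + l) / (k * l) * flow V k g"
    if kl: "l \<le> k" "card V = k + l" for k l and g :: "'a set \<Rightarrow> real"
  proof (cases "l = 0 \<or> k = 0")
    case True
    then have "card V choose k = 1" using kl by auto
    then obtain x0 where "ksets V k = {x0}"
      using less.prems(1) by (metis card_1_singletonE card_ksets)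
    then show ?thesis using True by (auto simp: ent_def)
  next
    case False
    then obtain j where j: "k = Suc j" by (cases k) auto
    define n where "n = real (card V)"
    define D where "D = flow V k g"
    define H where "H a = (\<Sum>x\<in>{x \<in> ksets V k. a \<in> x}. (g x)\<^sup>2)" for a
    define m where "m = (\<Sum>a\<in>V. H a) / card V"
    have D0: "0 \<le> D" by (simp add: D_def flow_nonneg)
    have n: "n = real k + real l" "n > 0" using kl False by (auto simp: n_def)
    have chain: "real k * ent (ksets V k) (\<lambda>x. (g x)\<^sup>2)
      = (\<Sum>a\<in>V. ent (ksets (V - {a}) j) (\<lambda>y. (g (insert a y))\<^sup>2)) + (\<Sum>a\<in>V. H a * ln (H a / m))"
      using ent_chain_rule[OF less.prems(1), of j l "\<lambda>x. (g x)\<^sup>2"] kl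
      by (simp add: j H_def m_def)
    have "(\<Sum>a\<in>V. ent (ksets (V - {a}) j) (\<lambda>y. (g (insert a y))\<^sup>2))
       \<le> (\<Sum>a\<in>V. 4 * (n - 1) / (j * l) * flow (V - {a}) j (\<lambda>y. g (insert a y)))"
    proof (rule sum_mono)
      fix a assume a: "a \<in> V"
      then have c: "card (V - {a}) = j + l" "card (V - {a}) < card V" "finite (V - {a})"
        using less.prems(1) kl j by (auto simp: card_gt_0_iff)
      have "n - 1 = real (j + l)" using n j by simp
      then show "ent (ksets (V - {a}) j) (\<lambda>y. (g (insert a y))\<^sup>2)
         \<le> 4 * (n - 1) / (j * l) * flow (V - {a}) j (\<lambda>y. g (insert a y))"
        using less.hyps[OF c(2,3,1), of "\<lambda>y. g (insert a y)"] by simp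
    qed
    also have "\<dots> = 4 * (n - 1) / (j * l) * (real j * D)"
      unfolding D_def j by (simp only: sum_distrib_left[symmetric] sum_flow_link[OF less.prems(1)])
    \<comment> \<open>an inequality and not an equation because of \<open>j = 0\<close>, where the left-hand side is \<open>0\<close>\<close>
    also have "\<dots> \<le> 4 * (n - 1) / l * D"
      using D0 n False by (cases "j = 0") (auto simp: j intro!: mult_nonneg_nonneg)
    finally have e1: "(\<Sum>a\<in>V. ent (ksets (V - {a}) j) (\<lambda>y. (g (insert a y))\<^sup>2)) \<le> 4 * (n - 1) / l * D" .
    have e2: "(\<Sum>a\<in>V. H a * ln (H a / m)) \<le> 4 / n * D"
    proof -
      define T where "T = (\<Sum>x\<in>ksets V k. (g x)\<^sup>2)"
      have sumH: "(\<Sum>a\<in>V. H a) = real k * T"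
      proof -
        have "(\<Sum>a\<in>V. H a) = (\<Sum>a\<in>V. \<Sum>x\<in>ksets V k. if a \<in> x then (g x)\<^sup>2 else 0)"
          unfolding H_def using less.prems(1) by (simp add: sum.inter_filter)
        also have "\<dots> = (\<Sum>x\<in>ksets V k. \<Sum>a\<in>V. if a \<in> x then (g x)\<^sup>2 else 0)"
          by (rule sum.swap)
        also have "\<dots> = (\<Sum>x\<in>ksets V k. real k * (g x)\<^sup>2)"
        proof (rule sum.cong[OF refl])
          fix x assume "x \<in> ksets V k"
          then have "x \<subseteq> V" "card x = k" by (auto simp: ksets_def)
          then show "(\<Sum>a\<in>V. if a \<in> x then (g x)\<^sup>2 else 0) = real k * (g x)\<^sup>2"
            using less.prems(1) by (simp add: sum.inter_restrict[symmetric] Int_absorb1)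
        qed
        finally show ?thesis by (simp add: T_def sum_distrib_left)
      qed
      have "T \<ge> 0" by (simp add: T_def sum_nonneg)
      have "H a \<le> 2 * m" for a
      proof -
        have "H a \<le> T" unfolding H_def T_def using less.prems(1) by (intro sum_mono2) auto
        also have "T \<le> 2 * (real k * T / n)"
        proof -
          have "T * n \<le> T * (2 * real k)" using n kl \<open>T \<ge> 0\<close> by (intro mult_left_mono) auto
          then show ?thesis using n by (simp add: field_simps)
        qed
        finally show ?thesis by (simp add: m_def sumH n_def)
      qed
      moreover have "0 \<le> H a" for a by (simp add: H_def sum_nonneg)
      ultimately have "(\<Sum>a\<in>V. H a * ln (H a / m))
          \<le> 4 / card V * (\<Sum>a\<in>V. \<Sum>b\<in>V. (sqrt (H a) - sqrt (H b))\<^sup>2)"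
        using less.prems(1) by (intro entropy_le_sqrt_differences) (auto simp: m_def)
      also have "\<dots> \<le> 4 / card V * D"
        unfolding D_def H_def using less.prems(1) by (intro mult_left_mono link_norm_differences) auto
      finally show ?thesis by (simp add: n_def)
    qed
    have "real k * ent (ksets V k) (\<lambda>x. (g x)\<^sup>2) \<le> 4 * (n - 1) / l * D + 4 / n * D"
      using chain e1 e2 by linarith
    also have "\<dots> = 4 * D / l * (n - 1 + l / n)" using n False by (simp add: field_simps)
    also have "\<dots> \<le> 4 * D / l * n"
      using D0 n by (intro mult_left_mono) (auto simp: field_simps)
    finally have "ent (ksets V k) (\<lambda>x. (g x)\<^sup>2) \<le> 4 * D / l * n / real k"
      using False by (simp add: pos_le_divide_eq mult_ac)
    also have "4 * D / l * n / real k = 4 * (k + l) / (k * l) * D"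
      using n(1) False by (simp add: field_simps)
    finally show ?thesis by (simp add: D_def)
  qed
  show ?case
  proof (cases "l \<le> k")
    case True
    then show ?thesis using ge less.prems(2) by blast
  next
    case False
    have "ent (ksets V l) (\<lambda>x. (g (V - x))\<^sup>2) \<le> 4 * (l + k) / (l * k) * flow V l (\<lambda>x. g (V - x))"
      using ge[of k l "\<lambda>x. g (V - x)"] False less.prems(2) by (simp add: add.commute)
    moreover have "card V = l + k" using less.prems(2) by simp
    note ent_complement[OF less.prems(1) this, of "\<lambda>x. (g x)\<^sup>2"] flow_complement[OF less.prems(1) this, of g]
    ultimately show ?thesis by (simp add: add.commute mult.commute)
  qed
qed

section \<open>Random walks generated by conjugation-closed involutions\<close>

lemma sum_inverse_sqrt_le: "(\<Sum>s<N. 1 / sqrt (real (Suc s))) \<le> 2 * sqrt (real N)"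
proof (induction N)
  case (Suc N)
  let ?a = "sqrt (real N)" and ?b = "sqrt (real (Suc N))"
  have b: "?b > 0" "?a \<le> ?b" by auto
  have "(?b - ?a) * (?b + ?a) = 1" by (simp add: algebra_simps)
  moreover have "(?b - ?a) * (?b + ?a) \<le> (?b - ?a) * (2 * ?b)" using b by (intro mult_left_mono) auto
  ultimately have "1 / ?b \<le> 2 * (?b - ?a)" using b(1) by (simp add: field_simps)
  then show ?case using Suc by simp
qed simp

text \<open>
  The setting in which the argument works: a finite set of involutions, closed under conjugation by
  its own members, acting on a finite set.
\<close>

locale involution_walk =
  fixes X :: "'x set" and U :: "('p \<Rightarrow> 'p) set" and act :: "('p \<Rightarrow> 'p) \<Rightarrow> 'x \<Rightarrow> 'x"
  assumes finite_X: "finite X" and X_nonempty: "X \<noteq> {}"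
    and finite_U: "finite U" and U_nonempty: "U \<noteq> {}"
    and act_in: "u \<in> U \<Longrightarrow> x \<in> X \<Longrightarrow> act u x \<in> X"
    and act_act: "u \<in> U \<Longrightarrow> act u (act u x) = x"
    and act_comp: "act (u \<circ> v) x = act u (act v x)"
    and involution: "u \<in> U \<Longrightarrow> u \<circ> u = id"
    and conj_in: "u \<in> U \<Longrightarrow> v \<in> U \<Longrightarrow> u \<circ> v \<circ> u \<in> U"
begin

definition mean :: "('x \<Rightarrow> real) \<Rightarrow> real" where
  "mean g = (\<Sum>x\<in>X. g x) / card X"

definition step :: "('x \<Rightarrow> real) \<Rightarrow> 'x \<Rightarrow> real" where
  "step g x = g x / 2 + (\<Sum>u\<in>U. g (act u x)) / (2 * card U)"

definition half_diff :: "('p \<Rightarrow> 'p) \<Rightarrow> ('x \<Rightarrow> real) \<Rightarrow> 'x \<Rightarrow> real" where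
  "half_diff u g x = (g (act u x) - g x) / 2"

definition gradsq :: "('x \<Rightarrow> real) \<Rightarrow> 'x \<Rightarrow> real" where
  "gradsq g x = (\<Sum>u\<in>U. (half_diff u g x)\<^sup>2) / card U"

definition dirichlet :: "('x \<Rightarrow> real) \<Rightarrow> real" where
  "dirichlet g = mean (gradsq g)"

lemma card_X_pos: "real (card X) > 0"
  using finite_X X_nonempty by (simp add: card_gt_0_iff)

lemma card_U_pos: "real (card U) > 0"
  using finite_U U_nonempty by (simp add: card_gt_0_iff)

lemma mean_add: "mean (\<lambda>x. f x + g x) = mean f + mean g"
  by (simp add: mean_def sum.distrib add_divide_distrib)

lemma mean_diff: "mean (\<lambda>x. f x - g x) = mean f - mean g"
  by (simp add: mean_def sum_subtractf diff_divide_distrib)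

lemma mean_scale: "mean (\<lambda>x. c * g x) = c * mean g"
  by (simp add: mean_def sum_distrib_left[symmetric])

lemma mean_const [simp]: "mean (\<lambda>x. c) = c"
  using card_X_pos by (simp add: mean_def)

lemma mean_mono: "(\<And>x. x \<in> X \<Longrightarrow> f x \<le> g x) \<Longrightarrow> mean f \<le> mean g"
  unfolding mean_def by (intro divide_right_mono sum_mono) auto

lemma mean_cong: "(\<And>x. x \<in> X \<Longrightarrow> f x = g x) \<Longrightarrow> mean f = mean g"
  unfolding mean_def by simp

lemma mean_nonneg: "(\<And>x. x \<in> X \<Longrightarrow> 0 \<le> f x) \<Longrightarrow> 0 \<le> mean f"
  unfolding mean_def by (intro divide_nonneg_nonneg sum_nonneg) auto

lemma mean_sum: "mean (\<lambda>x. \<Sum>i\<in>I. f i x) = (\<Sum>i\<in>I. mean (f i))"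
  unfolding mean_def by (subst sum.swap) (simp add: sum_divide_distrib)

lemma mean_divide: "mean (\<lambda>x. g x / c) = mean g / c"
  by (simp add: mean_def sum_divide_distrib mult.commute)

lemma mean_act: "u \<in> U \<Longrightarrow> mean (\<lambda>x. g (act u x)) = mean g"
  unfolding mean_def
  by (intro arg_cong2[where f = "(/)"] refl sum.reindex_bij_witness[where i = "act u" and j = "act u"])
    (auto simp: act_in act_act)

lemma mean_eq_0D:
  assumes "mean f = 0" "\<And>x. x \<in> X \<Longrightarrow> 0 \<le> f x" "x \<in> X"
  shows "f x = 0"
proof -
  have "(\<Sum>x\<in>X. f x) = 0" using assms(1) card_X_pos by (simp add: mean_def)
  then show ?thesis using assms(2,3) finite_X by (simp add: sum_nonneg_eq_0_iff)
qed

lemma step_mono: "(\<And>y. f y \<le> g y) \<Longrightarrow> step f x \<le> step g x"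
  unfolding step_def by (intro add_mono divide_right_mono sum_mono) auto

lemma step_mono_on: "(\<And>y. y \<in> X \<Longrightarrow> f y \<le> g y) \<Longrightarrow> x \<in> X \<Longrightarrow> step f x \<le> step g x"
  unfolding step_def by (intro add_mono divide_right_mono sum_mono) (auto simp: act_in)

lemma step_add: "step (\<lambda>y. f y + g y) x = step f x + step g x"
  by (simp add: step_def sum.distrib add_divide_distrib)

lemma step_scale: "step (\<lambda>y. c * g y) x = c * step g x"
  by (simp add: step_def sum_distrib_left[symmetric] field_simps)

lemma step_const [simp]: "step (\<lambda>y. c) x = c"
  using card_U_pos by (simp add: step_def)

lemma step_abs_le: "\<bar>step g x\<bar> \<le> step (\<lambda>y. \<bar>g y\<bar>) x"
proof -
  have "\<bar>step g x\<bar> \<le> \<bar>g x / 2\<bar> + \<bar>(\<Sum>u\<in>U. g (act u x)) / (2 * card U)\<bar>"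
    unfolding step_def by (rule abs_triangle_ineq)
  also have "\<dots> \<le> \<bar>g x\<bar> / 2 + (\<Sum>u\<in>U. \<bar>g (act u x)\<bar>) / (2 * card U)"
    by (simp add: abs_divide) (intro divide_right_mono sum_abs, simp)
  finally show ?thesis by (simp add: step_def)
qed

lemma mean_step: "mean (step g) = mean g"
proof -
  have "mean (step g) = mean g / 2 + (\<Sum>u\<in>U. mean (\<lambda>x. g (act u x))) / (2 * card U)"
    by (simp add: step_def[abs_def] mean_add mean_divide mean_sum)
  also have "\<dots> = mean g" using card_U_pos by (simp add: mean_act)
  finally show ?thesis .
qed

text \<open>
  Reindexing the sum over \<open>v\<close> by \<open>v \<mapsto> u v u\<close>, a bijection of \<open>U\<close> by closure under conjugation,
  moves \<open>u\<close> from one side of the step to the other.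
\<close>

lemma step_act:
  assumes "u \<in> U"
  shows "step (\<lambda>y. g (act u y)) x = step g (act u x)"
proof -
  have "(\<Sum>v\<in>U. g (act u (act v x))) = (\<Sum>v\<in>U. g (act v (act u x)))"
  proof (rule sum.reindex_bij_witness[where i = "\<lambda>v. u \<circ> v \<circ> u" and j = "\<lambda>v. u \<circ> v \<circ> u"])
    fix v assume "v \<in> U"
    have "u \<circ> (u \<circ> v \<circ> u) \<circ> u = (u \<circ> u) \<circ> v \<circ> (u \<circ> u)" by (simp only: o_assoc)
    then show "u \<circ> (u \<circ> v \<circ> u) \<circ> u = v" by (simp add: involution assms)
    then show "u \<circ> (u \<circ> v \<circ> u) \<circ> u = v" .
    show "u \<circ> v \<circ> u \<in> U" using \<open>v \<in> U\<close> assms by (rule conj_in[rotated])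
    then show "u \<circ> v \<circ> u \<in> U" .
    show "g (act (u \<circ> v \<circ> u) (act u x)) = g (act u (act v x))"
      by (simp add: act_comp act_act assms)
  qed
  then show ?thesis by (simp add: step_def)
qed

lemma half_diff_step: "u \<in> U \<Longrightarrow> half_diff u (step g) x = step (half_diff u g) x"
proof -
  assume u: "u \<in> U"
  have "step (half_diff u g) x = step (\<lambda>y. (1/2) * g (act u y) + (-1/2) * g y) x"
    by (rule arg_cong[where f = "\<lambda>h. step h x"]) (auto simp: half_diff_def field_simps)
  also have "\<dots> = (1/2) * step g (act u x) + (-1/2) * step g x"
    by (simp only: step_add step_scale step_act[OF u])
  finally show ?thesis by (simp add: half_diff_def field_simps)
qed

lemma half_diff_step_pow: "u \<in> U \<Longrightarrow> half_diff u ((step ^^ s) g) x = (step ^^ s) (half_diff u g) x"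
proof (induction s arbitrary: x)
  case (Suc s)
  have "half_diff u ((step ^^ s) g) = (step ^^ s) (half_diff u g)"
    using Suc by (intro ext) auto
  then show ?case using half_diff_step[OF Suc.prems, of "(step ^^ s) g" x] by simp
qed simp

lemma mean_mult_step: "mean (\<lambda>x. f x * step g x) = mean (\<lambda>x. step f x * g x)"
proof -
  have *: "mean (\<lambda>x. f x * g (act u x)) = mean (\<lambda>x. f (act u x) * g x)" if "u \<in> U" for u
    using mean_act[OF that, of "\<lambda>x. f x * g (act u x)"] that by (simp add: act_act)
  have "mean (\<lambda>x. f x * step g x)
      = mean (\<lambda>x. f x * g x / 2 + (\<Sum>u\<in>U. f x * g (act u x)) / (2 * card U))"
    by (simp add: step_def distrib_left sum_distrib_left)
  also have "\<dots> = mean (\<lambda>x. f x * g x / 2 + (\<Sum>u\<in>U. f (act u x) * g x) / (2 * card U))"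
    by (simp add: mean_add mean_divide mean_sum *)
  also have "\<dots> = mean (\<lambda>x. step f x * g x)"
    by (simp add: step_def distrib_right sum_distrib_right)
  finally show ?thesis .
qed

lemma mean_mult_step_pow: "mean (\<lambda>x. f x * (step ^^ s) g x) = mean (\<lambda>x. (step ^^ s) f x * g x)"
proof (induction s arbitrary: f)
  case (Suc s)
  have "mean (\<lambda>x. f x * (step ^^ Suc s) g x) = mean (\<lambda>x. step f x * (step ^^ s) g x)"
    by (simp add: mean_mult_step)
  also have "\<dots> = mean (\<lambda>x. (step ^^ s) (step f) x * g x)" by (rule Suc)
  finally show ?case by (simp add: funpow_swap1)
qed simp

text \<open>
  Summation by parts: invariance of the mean under \<open>u\<close> symmetrises \<open>f \<cdot> (g - g \<circ> u)\<close>.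
\<close>

lemma mean_mult_diff_step:
  "mean (\<lambda>x. f x * (g x - step g x)) = mean (\<lambda>x. (\<Sum>u\<in>U. half_diff u f x * half_diff u g x) / card U)"
proof -
  have *: "mean (\<lambda>x. half_diff u f x * half_diff u g x) = mean (\<lambda>x. - (f x * half_diff u g x))"
    if u: "u \<in> U" for u
  proof -
    have "mean (\<lambda>x. f (act u x) * half_diff u g x) = mean (\<lambda>x. - (f x * half_diff u g x))"
    proof -
      have "mean (\<lambda>x. f (act u x) * half_diff u g x) = mean (\<lambda>x. f x * half_diff u g (act u x))"
        using mean_act[OF u, of "\<lambda>x. f x * half_diff u g (act u x)"] u by (simp add: act_act)
      also have "\<dots> = mean (\<lambda>x. - (f x * half_diff u g x))"
        using u by (intro mean_cong) (simp add: half_diff_def act_act field_simps)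
      finally show ?thesis .
    qed
    moreover have "mean (\<lambda>x. half_diff u f x * half_diff u g x)
        = mean (\<lambda>x. f (act u x) * half_diff u g x / 2 + - (f x * half_diff u g x) / 2)"
      by (rule mean_cong) (simp add: half_diff_def field_simps)
    ultimately show ?thesis by (simp only: mean_add mean_divide)
  qed
  have "g x - step g x = (\<Sum>u\<in>U. - half_diff u g x) / card U" for x
    using card_U_pos
    by (simp add: step_def half_diff_def sum_negf sum_divide_distrib[symmetric] sum_subtractf field_simps)
  then have "mean (\<lambda>x. f x * (g x - step g x)) = mean (\<lambda>x. (\<Sum>u\<in>U. - (f x * half_diff u g x)) / card U)"
    by (simp add: sum_distrib_left)
  also have "\<dots> = mean (\<lambda>x. (\<Sum>u\<in>U. half_diff u f x * half_diff u g x) / card U)"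
    by (simp add: mean_divide mean_sum * del: sum_negf)
  finally show ?thesis .
qed

lemma gradsq_nonneg: "0 \<le> gradsq g x"
  unfolding gradsq_def by (intro divide_nonneg_nonneg sum_nonneg) auto

text \<open>
  The right-hand side is the variance of \<open>g\<close> after one step from \<open>x\<close>. The walk stays at \<open>x\<close> with
  probability \<open>1/2\<close>, so comparing only with \<open>g x\<close> already accounts for the squared gradient.
\<close>

lemma gradsq_le_step_variance: "gradsq g x \<le> step (\<lambda>y. (g y)\<^sup>2) x - (step g x)\<^sup>2"
proof -
  let ?N = "real (card U)"
  define a where "a = g x"
  define d where "d u = half_diff u g x" for u
  define S where "S = (\<Sum>u\<in>U. d u)"
  define Q where "Q = (\<Sum>u\<in>U. (d u)\<^sup>2)"
  have N: "?N > 0" by (rule card_U_pos)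
  have gu: "g (act u x) = a + 2 * d u" for u by (simp add: a_def d_def half_diff_def field_simps)
  have "(\<Sum>u\<in>U. g (act u x)) = ?N * a + 2 * S"
    by (simp add: gu sum.distrib S_def sum_distrib_left)
  then have s1: "step g x = a + S / ?N"
    using N by (simp add: step_def a_def[symmetric] field_simps)
  have "(\<Sum>u\<in>U. (g (act u x))\<^sup>2) = (\<Sum>u\<in>U. a\<^sup>2 + 4 * a * d u + 4 * (d u)\<^sup>2)"
    by (simp add: gu power2_sum power_mult_distrib mult.assoc add_ac)
  also have "\<dots> = ?N * a\<^sup>2 + 4 * a * S + 4 * Q"
    by (simp add: sum.distrib S_def Q_def sum_distrib_left)
  finally have s2: "step (\<lambda>y. (g y)\<^sup>2) x = a\<^sup>2 + 2 * a * (S / ?N) + 2 * (Q / ?N)"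
    using N by (simp add: step_def a_def[symmetric] field_simps)
  have "S\<^sup>2 \<le> Q * ?N"
    using Cauchy_Schwarz_ineq_sum[of d "\<lambda>_. 1" U] by (simp add: S_def Q_def)
  then have "(S / ?N)\<^sup>2 \<le> Q / ?N" using N by (simp add: power_divide power2_eq_square field_simps)
  then show ?thesis by (simp add: s1 s2 gradsq_def d_def[symmetric] Q_def[symmetric] power2_sum)
qed

lemma step_power2_le: "(step g x)\<^sup>2 \<le> step (\<lambda>y. (g y)\<^sup>2) x"
  using gradsq_le_step_variance[of g x] gradsq_nonneg[of g x] by simp

text \<open>
  The Bakry-Emery commutation of gradient and walk with curvature zero: each \<open>half_diff u\<close> commutes
  with \<open>step\<close>, and \<open>(step h)\<^sup>2 \<le> step (h\<^sup>2)\<close>.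
\<close>

lemma gradsq_step_le: "gradsq (step g) x \<le> step (gradsq g) x"
proof -
  have "gradsq (step g) x = (\<Sum>u\<in>U. (step (half_diff u g) x)\<^sup>2) / card U"
    by (simp add: gradsq_def half_diff_step)
  also have "\<dots> \<le> (\<Sum>u\<in>U. step (\<lambda>y. (half_diff u g y)\<^sup>2) x) / card U"
    by (intro divide_right_mono sum_mono step_power2_le) simp
  also have "\<dots> = step (gradsq g) x"
  proof -
    have "(\<Sum>u\<in>U. \<Sum>v\<in>U. (half_diff u g (act v x))\<^sup>2) = (\<Sum>v\<in>U. \<Sum>u\<in>U. (half_diff u g (act v x))\<^sup>2)"
      by (rule sum.swap)
    then show ?thesis
      by (simp add: step_def gradsq_def sum.distrib sum_divide_distrib[symmetric] add_divide_distrib)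
  qed
  finally show ?thesis .
qed

text \<open>
  The variance of \<open>g\<close> after \<open>s + 1\<close> steps is a sum of one-step variances of the functions
  \<open>step\<^sup>j g\<close>, each carried on by the remaining steps. By the two preceding lemmas each of the \<open>s + 1\<close>
  summands dominates the squared gradient of the smoothest of these functions.
\<close>

lemma reverse_poincare:
  "real (Suc s) * gradsq ((step ^^ s) g) x
     \<le> (step ^^ Suc s) (\<lambda>y. (g y)\<^sup>2) x - ((step ^^ Suc s) g x)\<^sup>2"
proof (induction s arbitrary: x)
  case 0
  show ?case using gradsq_le_step_variance[of g x] by simp
next
  case (Suc s)
  let ?h = "\<lambda>j. (step ^^ j) g"
  have "step (\<lambda>y. (?h (Suc s) y)\<^sup>2 + real (Suc s) * gradsq (?h s) y) x
      \<le> step ((step ^^ Suc s) (\<lambda>y. (g y)\<^sup>2)) x"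
    by (rule step_mono) (use Suc in \<open>simp add: algebra_simps\<close>)
  moreover have "step (\<lambda>y. (?h (Suc s) y)\<^sup>2 + real (Suc s) * gradsq (?h s) y) x
      = step (\<lambda>y. (?h (Suc s) y)\<^sup>2) x + real (Suc s) * step (gradsq (?h s)) x"
    by (simp only: step_add step_scale)
  moreover have "gradsq (?h (Suc s)) x \<le> step (\<lambda>y. (?h (Suc s) y)\<^sup>2) x - (?h (Suc (Suc s)) x)\<^sup>2"
    using gradsq_le_step_variance[of "?h (Suc s)" x] by simp
  moreover have "real (Suc s) * gradsq (?h (Suc s)) x \<le> real (Suc s) * step (gradsq (?h s)) x"
    using gradsq_step_le[of "?h s" x] by (intro mult_left_mono) auto
  ultimately show ?case by (simp add: algebra_simps)
qed

lemma step_pow_mono_on: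
  "(\<And>y. y \<in> X \<Longrightarrow> f y \<le> g y) \<Longrightarrow> x \<in> X \<Longrightarrow> (step ^^ s) f x \<le> (step ^^ s) g x"
  by (induction s arbitrary: x) (auto intro: step_mono_on)

lemma step_pow_const [simp]: "(step ^^ s) (\<lambda>_. c) = (\<lambda>_. c)"
proof (induction s)
  case (Suc s)
  have "step (\<lambda>_. c) = (\<lambda>_. c)" by (rule ext) simp
  then show ?case by (simp add: Suc)
qed simp

lemma step_pow_affine: "(step ^^ s) (\<lambda>y. a * g y + b) x = a * (step ^^ s) g x + b"
proof (induction s arbitrary: x)
  case (Suc s)
  have "(step ^^ s) (\<lambda>y. a * g y + b) = (\<lambda>x. a * (step ^^ s) g x + b)" using Suc by (intro ext)
  then show ?case by (simp add: step_add step_scale)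
qed simp

lemma sqrt_gradsq_step_pow_le:
  assumes "\<And>y. y \<in> X \<Longrightarrow> \<bar>g y\<bar> \<le> 1" "x \<in> X"
  shows "sqrt (gradsq ((step ^^ s) g) x) \<le> 1 / sqrt (real (Suc s))"
proof -
  have "(step ^^ Suc s) (\<lambda>y. (g y)\<^sup>2) x \<le> (step ^^ Suc s) (\<lambda>_. 1) x"
    using assms by (intro step_pow_mono_on) (auto simp: abs_square_le_1)
  also have "\<dots> = 1" by (simp only: step_pow_const)
  finally have "real (Suc s) * gradsq ((step ^^ s) g) x \<le> 1"
    using reverse_poincare[of s g x] by (smt (verit) zero_le_power2)
  then have "gradsq ((step ^^ s) g) x \<le> 1 / real (Suc s)" by (simp add: field_simps)
  then have "sqrt (gradsq ((step ^^ s) g) x) \<le> sqrt (1 / real (Suc s))" by (rule real_sqrt_le_mono)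
  then show ?thesis by (simp add: real_sqrt_divide)
qed

text \<open>
  Write the difference as a telescoping sum, move \<open>s\<close> steps from \<open>f\<close> to \<open>g\<close> by symmetry and sum by
  parts: each summand is the mean of the inner product of the gradients of \<open>step\<^sup>s g\<close> and \<open>f\<close>. The
  first of them is at most \<open>1/\<surd>(s+1)\<close> pointwise.
\<close>

lemma displacement_le_gradient:
  assumes "\<And>y. y \<in> X \<Longrightarrow> \<bar>g y\<bar> \<le> 1"
  shows "mean (\<lambda>x. g x * f x) - mean (\<lambda>x. g x * (step ^^ N) f x)
           \<le> 2 * sqrt (real N) * mean (\<lambda>x. sqrt (gradsq f x))"
proof -
  let ?M = "mean (\<lambda>x. sqrt (gradsq f x))"
  have M0: "0 \<le> ?M" by (intro mean_nonneg) (simp add: gradsq_nonneg)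
  have one: "mean (\<lambda>x. g x * (step ^^ s) f x) - mean (\<lambda>x. g x * (step ^^ Suc s) f x)
      \<le> 1 / sqrt (real (Suc s)) * ?M" for s
  proof -
    let ?h = "(step ^^ s) g"
    have "mean (\<lambda>x. g x * (step ^^ s) f x) - mean (\<lambda>x. g x * (step ^^ Suc s) f x)
        = mean (\<lambda>x. ?h x * f x) - mean (\<lambda>x. ?h x * step f x)"
      using mean_mult_step_pow[of g s f] mean_mult_step_pow[of g s "step f"] by (simp add: funpow_swap1)
    also have "\<dots> = mean (\<lambda>x. ?h x * (f x - step f x))"
      by (simp add: mean_diff[symmetric] right_diff_distrib)
    also have "\<dots> = mean (\<lambda>x. (\<Sum>u\<in>U. half_diff u ?h x * half_diff u f x) / card U)"
      by (rule mean_mult_diff_step)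
    also have "\<dots> \<le> mean (\<lambda>x. 1 / sqrt (real (Suc s)) * sqrt (gradsq f x))"
    proof (rule mean_mono)
      fix x assume x: "x \<in> X"
      have "(\<Sum>u\<in>U. half_diff u ?h x * half_diff u f x)
          \<le> (\<Sum>u\<in>U. \<bar>half_diff u ?h x\<bar> * \<bar>half_diff u f x\<bar>)"
        by (intro sum_mono) (simp add: abs_mult[symmetric])
      also have "\<dots> \<le> L2_set (\<lambda>u. half_diff u ?h x) U * L2_set (\<lambda>u. half_diff u f x) U"
        by (rule L2_set_mult_ineq)
      finally have "(\<Sum>u\<in>U. half_diff u ?h x * half_diff u f x) / card U
          \<le> L2_set (\<lambda>u. half_diff u ?h x) U * L2_set (\<lambda>u. half_diff u f x) U / card U"
        by (rule divide_right_mono) simp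
      also have "\<dots> = sqrt (gradsq ?h x) * sqrt (gradsq f x)"
        using card_U_pos by (simp add: gradsq_def L2_set_def real_sqrt_divide)
      also have "\<dots> \<le> 1 / sqrt (real (Suc s)) * sqrt (gradsq f x)"
        by (rule mult_right_mono[OF sqrt_gradsq_step_pow_le[OF assms x]]) (auto simp: gradsq_nonneg)
      finally show "(\<Sum>u\<in>U. half_diff u ?h x * half_diff u f x) / card U
          \<le> 1 / sqrt (real (Suc s)) * sqrt (gradsq f x)" .
    qed
    also have "\<dots> = 1 / sqrt (real (Suc s)) * ?M" by (rule mean_scale)
    finally show ?thesis .
  qed
  have "mean (\<lambda>x. g x * f x) - mean (\<lambda>x. g x * (step ^^ N) f x)
      = (\<Sum>s<N. mean (\<lambda>x. g x * (step ^^ s) f x) - mean (\<lambda>x. g x * (step ^^ Suc s) f x))"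
    by (subst sum_lessThan_telescope') simp
  also have "\<dots> \<le> (\<Sum>s<N. 1 / sqrt (real (Suc s)) * ?M)" by (intro sum_mono one)
  also have "\<dots> = (\<Sum>s<N. 1 / sqrt (real (Suc s))) * ?M" by (simp add: sum_distrib_right)
  also have "\<dots> \<le> 2 * sqrt (real N) * ?M" using M0 by (intro mult_right_mono sum_inverse_sqrt_le)
  finally show ?thesis .
qed

lemma dirichlet_eq: "dirichlet g = mean (\<lambda>x. g x * (g x - step g x))"
  by (simp add: dirichlet_def gradsq_def[abs_def] mean_mult_diff_step power2_eq_square)

lemma dirichlet_sum: "dirichlet g = (\<Sum>u\<in>U. mean (\<lambda>x. (half_diff u g x)\<^sup>2)) / card U"
  by (simp add: dirichlet_def gradsq_def[abs_def] mean_divide mean_sum)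

lemma dirichlet_le_energy_drop: "dirichlet g \<le> mean (\<lambda>x. (g x)\<^sup>2) - mean (\<lambda>x. (step g x)\<^sup>2)"
proof -
  have "dirichlet g \<le> mean (\<lambda>x. step (\<lambda>y. (g y)\<^sup>2) x - (step g x)\<^sup>2)"
    unfolding dirichlet_def by (intro mean_mono gradsq_le_step_variance)
  then show ?thesis by (simp add: mean_diff mean_step)
qed

text \<open>
  With \<open>I\<close> the identity and \<open>R\<close> the step, this is \<open>I - R\<^sup>2 = 2 (I - R) - (I - R)\<^sup>2\<close>, where the last square is
  nonnegative as a quadratic form.
\<close>

lemma energy_drop_le_dirichlet: "mean (\<lambda>x. (g x)\<^sup>2) - mean (\<lambda>x. (step g x)\<^sup>2) \<le> 2 * dirichlet g"
proof -
  have "mean (\<lambda>x. (g x)\<^sup>2 - (step g x)\<^sup>2) \<le> mean (\<lambda>x. 2 * (g x * (g x - step g x)))"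
  proof (rule mean_mono)
    fix x
    have "0 \<le> (g x - step g x)\<^sup>2" by simp
    then show "(g x)\<^sup>2 - (step g x)\<^sup>2 \<le> 2 * (g x * (g x - step g x))"
      by (simp add: power2_eq_square algebra_simps)
  qed
  then show ?thesis by (simp add: mean_diff mean_scale dirichlet_eq)
qed

lemma dirichlet_nonneg: "0 \<le> dirichlet g"
  unfolding dirichlet_def by (intro mean_nonneg gradsq_nonneg)

end

section \<open>Consequences of a logarithmic Sobolev inequality\<close>

lemma exp_minus_le_linear:
  fixes z :: real
  assumes "0 \<le> z" "z \<le> 1"
  shows "exp (- z) \<le> 1 - z / 2"
proof -
  have "exp (- z) \<le> 1 / (1 + z)"
    using assms exp_ge_add_one_self[of z] by (simp add: exp_minus field_simps)
  also have "\<dots> \<le> 1 - z / 2"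
  proof -
    have "z * z \<le> z * 1" using assms by (intro mult_left_mono) auto
    then show ?thesis using assms by (simp add: field_simps)
  qed
  finally show ?thesis .
qed

lemma one_minus_exp_ge:
  fixes z :: real
  assumes "0 \<le> z"
  shows "z / (1 + z) \<le> 1 - exp (- z)"
proof -
  have "exp (- z) \<le> 1 / (1 + z)"
    using assms exp_ge_add_one_self[of z] by (simp add: exp_minus field_simps)
  moreover have "z / (1 + z) = 1 - 1 / (1 + z)" using assms by (simp add: field_simps)
  ultimately show ?thesis by simp
qed

text \<open>
  With \<open>r = t\<^bsup>1/4\<^esup>\<close>, the claim divided by \<open>t/4\<close> reads
  \<open>(1 - r) (3 - r - r\<^sup>2 - r\<^sup>3) \<ge> 0\<close>.
\<close>

lemma powr_five_quarters_le:
  fixes t :: real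
  assumes "0 \<le> t" "t \<le> 1"
  shows "t powr (5/4) \<le> t\<^sup>2 + 3/4 * (t - t\<^sup>2)"
proof (cases "t = 0")
  case False
  with assms have t: "t > 0" by simp
  define r where "r = t powr (1/4)"
  have r: "0 < r" "r \<le> 1" using t assms by (auto simp: r_def powr_le1)
  have r4: "r ^ 4 = t" using t by (simp add: r_def powr_power)
  have "t powr (5/4) = t * r"
    using t powr_add[of t 1 "1/4"] by (simp add: r_def)
  moreover have "r \<le> r ^ 4 + 3/4 * (1 - r ^ 4)"
  proof -
    have "0 \<le> (1 - r) * (3 - r - r\<^sup>2 - r ^ 3)"
    proof (rule mult_nonneg_nonneg)
      have "r\<^sup>2 \<le> 1" "r ^ 3 \<le> 1" using r by (auto intro: power_le_one)
      then show "0 \<le> 3 - r - r\<^sup>2 - r ^ 3" using r by linarith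
    qed (use r in simp)
    also have "(1 - r) * (3 - r - r\<^sup>2 - r ^ 3) = 3 - 4 * r + r ^ 4"
      by (simp add: eval_nat_numeral algebra_simps)
    finally show ?thesis by (simp add: field_simps)
  qed
  then have "t * r \<le> t * (t + 3/4 * (1 - t))" using t by (simp add: r4)
  ultimately show ?thesis by (simp add: power2_eq_square algebra_simps)
qed simp

text \<open>
  The bracket is the entropy of \<open>g\<^sup>2\<close> under the uniform distribution. The factor \<open>2\<close> leaves
  room for \<open>\<kappa> (1 + ln (1/t)) \<le> 1\<close>, where \<open>t\<close> is the measure of a nonempty set; the number of steps in
  \<open>surface_area_minority\<close> is positive for this reason.
\<close>

locale log_sobolev_walk = involution_walk X U act
  for X :: "'x set" and U :: "('p \<Rightarrow> 'p) set" and act :: "('p \<Rightarrow> 'p) \<Rightarrow> 'x \<Rightarrow> 'x" +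
  fixes \<kappa> :: real
  assumes kappa: "0 < \<kappa>" "\<kappa> \<le> 1 / 2"
    and log_sobolev: "2 * \<kappa> * (mean (\<lambda>x. (g x)\<^sup>2 * ln ((g x)\<^sup>2))
          - mean (\<lambda>x. (g x)\<^sup>2) * ln (mean (\<lambda>x. (g x)\<^sup>2))) \<le> dirichlet g"
begin

text \<open>
  Jensen's inequality for the logarithm under the probability weight \<open>g\<^sup>2 / b\<close> bounds the entropy of
  \<open>g\<^sup>2\<close> from below by \<open>b ln (b / m\<^sup>2)\<close>. In this form the logarithmic Sobolev inequality involves only
  two norms of \<open>g\<close>.
\<close>

lemma nash_inequality:
  defines "b \<equiv> \<lambda>g. mean (\<lambda>x. (g x)\<^sup>2)" and "m \<equiv> \<lambda>g. mean (\<lambda>x. \<bar>g x\<bar>)"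
  assumes b: "b g > 0"
  shows "m g > 0" and "2 * \<kappa> * (b g * ln (b g / (m g)\<^sup>2)) \<le> dirichlet g"
proof -
  define B where "B = b g"
  define M where "M = m g"
  have M0: "M \<ge> 0" unfolding M_def m_def by (intro mean_nonneg) simp
  have "M \<noteq> 0"
  proof
    assume "M = 0"
    then have "g x = 0" if "x \<in> X" for x
      using mean_eq_0D[of "\<lambda>x. \<bar>g x\<bar>" x] that by (simp add: M_def m_def)
    then have "b g = mean (\<lambda>x. 0)" unfolding b_def by (intro mean_cong) simp
    then show False using b by simp
  qed
  with M0 have M: "M > 0" by simp
  then show "m g > 0" by (simp add: M_def)
  have B: "B > 0" using b by (simp add: B_def)
  \<comment> \<open>Jensen made explicit: the tangent inequality \<open>ln z \<le> z - 1\<close> at \<open>z = b / (m |g x|)\<close>, whose error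
    has mean zero\<close>
  have pt: "(g x)\<^sup>2 * ln ((g x)\<^sup>2) \<ge> (2 * ln (B / M)) * (g x)\<^sup>2 + 2 * (g x)\<^sup>2 - 2 * (B / M) * \<bar>g x\<bar>" for x
  proof (cases "g x = 0")
    case False
    define y where "y = \<bar>g x\<bar>"
    have y: "y > 0" "(g x)\<^sup>2 = y\<^sup>2" using False by (auto simp: y_def)
    have "ln (B / M / y) \<le> B / M / y - 1" using B M y by (intro ln_le_minus_one) simp
    moreover have "ln (B / M / y) = ln (B / M) - ln y" using B M y by (simp add: ln_div ln_mult)
    ultimately have "ln y \<ge> ln (B / M) + 1 - B / M / y" by simp
    then have "2 * y\<^sup>2 * ln y \<ge> 2 * y\<^sup>2 * (ln (B / M) + 1 - B / M / y)"
      by (intro mult_left_mono) auto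
    moreover have "2 * y\<^sup>2 * (ln (B / M) + 1 - B / M / y) = y\<^sup>2 * (2 * ln (B / M)) + 2 * y\<^sup>2 - 2 * (B / M) * y"
      using y M by (simp add: power2_eq_square field_simps)
    moreover have "ln (y\<^sup>2) = 2 * ln y" using y by (simp add: ln_realpow)
    then have "y\<^sup>2 * ln (y\<^sup>2) = 2 * y\<^sup>2 * ln y" by simp
    ultimately have "y\<^sup>2 * ln (y\<^sup>2) \<ge> y\<^sup>2 * (2 * ln (B / M)) + 2 * y\<^sup>2 - 2 * (B / M) * y"
      by linarith
    then show ?thesis by (simp only: y(2) y_def[symmetric] mult.commute[of _ "2 * ln (B / M)"])
  qed simp
  have "mean (\<lambda>x. (2 * ln (B / M)) * (g x)\<^sup>2 + 2 * (g x)\<^sup>2 - 2 * (B / M) * \<bar>g x\<bar>)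
      = (2 * ln (B / M)) * B + 2 * B - 2 * (B / M) * M"
    by (simp only: mean_diff mean_add mean_scale B_def b_def M_def m_def)
  also have "\<dots> = 2 * B * ln (B / M)" using M by simp
  finally have "mean (\<lambda>x. (g x)\<^sup>2 * ln ((g x)\<^sup>2)) \<ge> 2 * B * ln (B / M)"
    using mean_mono[of "\<lambda>x. (2 * ln (B / M)) * (g x)\<^sup>2 + 2 * (g x)\<^sup>2 - 2 * (B / M) * \<bar>g x\<bar>"
        "\<lambda>x. (g x)\<^sup>2 * ln ((g x)\<^sup>2)"] pt by simp
  moreover have "B * ln (B / M\<^sup>2) = 2 * B * ln (B / M) - B * ln B"
    using B M by (simp add: ln_div ln_realpow algebra_simps)
  ultimately have "B * ln (B / M\<^sup>2) \<le> mean (\<lambda>x. (g x)\<^sup>2 * ln ((g x)\<^sup>2)) - B * ln B"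
    by linarith
  then have "2 * \<kappa> * (B * ln (B / M\<^sup>2))
      \<le> 2 * \<kappa> * (mean (\<lambda>x. (g x)\<^sup>2 * ln ((g x)\<^sup>2)) - B * ln B)"
    using kappa by (intro mult_left_mono) auto
  also have "\<dots> \<le> dirichlet g" using log_sobolev[of g] by (simp add: B_def b_def)
  finally show "2 * \<kappa> * (b g * ln (b g / (m g)\<^sup>2)) \<le> dirichlet g" by (simp add: B_def M_def)
qed

lemma mean_abs_step_pow_le: "mean (\<lambda>x. \<bar>(step ^^ s) g x\<bar>) \<le> mean (\<lambda>x. \<bar>g x\<bar>)"
proof (induction s)
  case (Suc s)
  have "mean (\<lambda>x. \<bar>(step ^^ Suc s) g x\<bar>) \<le> mean (step (\<lambda>y. \<bar>(step ^^ s) g y\<bar>))"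
    by (intro mean_mono) (simp add: step_abs_le)
  also have "\<dots> = mean (\<lambda>y. \<bar>(step ^^ s) g y\<bar>)" by (rule mean_step)
  finally show ?case using Suc by simp
qed simp

text \<open>
  The energy loses at least the Dirichlet form in each step, so Nash's inequality gives
  \<open>b (s+1) \<le> b s (1 - 2\<kappa> ln (b s / m\<^sup>2))\<close>, with the \<open>L\<^sup>1\<close> norm of the iterates replaced by its initial
  value \<open>m\<close>. Thus \<open>ln (b s / m\<^sup>2)\<close> shrinks by the factor \<open>1 - 2\<kappa>\<close> in each step.
\<close>

lemma energy_decay:
  fixes g
  defines "b \<equiv> \<lambda>s. mean (\<lambda>x. ((step ^^ s) g x)\<^sup>2)" and "m \<equiv> mean (\<lambda>x. \<bar>g x\<bar>)"
  assumes m: "m > 0"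
  shows "b s \<le> m\<^sup>2 * (b 0 / m\<^sup>2) powr ((1 - 2 * \<kappa>) ^ s)"
proof (induction s)
  case 0
  have "b 0 \<ge> 0" unfolding b_def by (intro mean_nonneg) simp
  then show ?case using m by simp
next
  case (Suc s)
  let ?h = "(step ^^ s) g"
  define B where "B = b s"
  have drop: "b (Suc s) \<le> B - dirichlet ?h"
    using dirichlet_le_energy_drop[of ?h] by (simp add: b_def B_def)
  have B0: "B \<ge> 0" unfolding B_def b_def by (intro mean_nonneg) simp
  have "b (Suc s) \<le> m\<^sup>2 * (B / m\<^sup>2) powr (1 - 2 * \<kappa>)"
  proof (cases "B = 0")
    case True
    then show ?thesis using drop dirichlet_nonneg[of ?h] by simp
  next
    case False
    with B0 have B: "B > 0" by simp
    define M where "M = mean (\<lambda>x. \<bar>?h x\<bar>)"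
    have M: "M > 0" "2 * \<kappa> * (B * ln (B / M\<^sup>2)) \<le> dirichlet ?h"
      using nash_inequality[of ?h] B by (auto simp: B_def b_def M_def)
    have "M \<le> m" unfolding M_def m_def by (rule mean_abs_step_pow_le)
    then have "M\<^sup>2 \<le> m\<^sup>2" using M by (intro power_mono) auto
    then have "B / m\<^sup>2 \<le> B / M\<^sup>2" using B M m by (intro divide_left_mono) auto
    then have "ln (B / m\<^sup>2) \<le> ln (B / M\<^sup>2)" using B m by (intro ln_mono) auto
    then have "2 * \<kappa> * (B * ln (B / m\<^sup>2)) \<le> 2 * \<kappa> * (B * ln (B / M\<^sup>2))"
      using B kappa by (intro mult_left_mono) auto
    then have "b (Suc s) \<le> B * (1 + (- (2 * \<kappa>) * ln (B / m\<^sup>2)))"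
      using drop M(2) by (simp add: algebra_simps)
    also have "\<dots> \<le> B * exp (- (2 * \<kappa>) * ln (B / m\<^sup>2))"
      using B exp_ge_add_one_self[of "- (2 * \<kappa>) * ln (B / m\<^sup>2)"] by (intro mult_left_mono) auto
    also have "\<dots> = B * (B / m\<^sup>2) powr (- (2 * \<kappa>))"
      using B m by (simp add: powr_def)
    also have "\<dots> = m\<^sup>2 * ((B / m\<^sup>2) powr 1 * (B / m\<^sup>2) powr (- (2 * \<kappa>)))"
      using B m by simp
    also have "\<dots> = m\<^sup>2 * (B / m\<^sup>2) powr (1 - 2 * \<kappa>)"
      by (simp only: powr_add[symmetric]) simp
    finally show ?thesis .
  qed
  also have "\<dots> \<le> m\<^sup>2 * ((b 0 / m\<^sup>2) powr ((1 - 2 * \<kappa>) ^ s)) powr (1 - 2 * \<kappa>)"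
  proof -
    have "B / m\<^sup>2 \<le> (b 0 / m\<^sup>2) powr ((1 - 2 * \<kappa>) ^ s)"
      using Suc m by (simp add: B_def field_simps)
    then show ?thesis using kappa B0 m by (intro mult_left_mono powr_mono2) auto
  qed
  also have "\<dots> = m\<^sup>2 * (b 0 / m\<^sup>2) powr ((1 - 2 * \<kappa>) ^ Suc s)"
    by (simp add: powr_powr mult.commute)
  finally show ?case .
qed

text \<open>
  The hypothesis says that \<open>|g|\<close> is the indicator of a set, of measure \<open>t\<close>. Then \<open>b 0 = t\<close> and
  \<open>b 0 / m\<^sup>2 = 1/t\<close> in the decay estimate, and \<open>(1 - 2\<kappa>)\<^sup>s \<le> 1 - \<kappa>s/2\<close> in the stated range of \<open>s\<close>.
\<close>

lemma small_set_expansion: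
  assumes g: "\<And>x. x \<in> X \<Longrightarrow> (g x)\<^sup>2 = \<bar>g x\<bar>" and s: "\<kappa> * real s \<le> 1"
  shows "mean (\<lambda>x. ((step ^^ s) g x)\<^sup>2) \<le> mean (\<lambda>x. \<bar>g x\<bar>) powr (1 + \<kappa> * real s / 2)"
proof -
  define t where "t = mean (\<lambda>x. \<bar>g x\<bar>)"
  have b0: "mean (\<lambda>x. (g x)\<^sup>2) = t" unfolding t_def by (intro mean_cong g)
  have g1: "\<bar>g x\<bar> \<le> 1" if "x \<in> X" for x
  proof -
    have "\<bar>g x\<bar> * \<bar>g x\<bar> = \<bar>g x\<bar>" using g[OF that] by (metis power2_abs power2_eq_square)
    then show ?thesis by (metis mult_cancel_left2 order_refl zero_le_one)
  qed
  have "t \<le> mean (\<lambda>_. 1)" unfolding t_def by (intro mean_mono g1)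
  then have t1: "t \<le> 1" by simp
  have t0: "t \<ge> 0" unfolding t_def by (intro mean_nonneg) simp
  show ?thesis
  proof (cases "t = 0")
    case True
    then have "g x = 0" if "x \<in> X" for x
      using mean_eq_0D[of "\<lambda>x. \<bar>g x\<bar>" x] that by (simp add: t_def)
    then have "\<bar>(step ^^ s) g x\<bar> \<le> 0" if "x \<in> X" for x
      using step_pow_mono_on[of g "\<lambda>_. 0" x s] step_pow_mono_on[of "\<lambda>_. 0" g x s] that by auto
    then have "mean (\<lambda>x. ((step ^^ s) g x)\<^sup>2) = mean (\<lambda>_. 0)" by (intro mean_cong) auto
    then show ?thesis by simp
  next
    case False
    with t0 have t: "t > 0" by simp
    have "(1 - 2 * \<kappa>) ^ s \<le> exp (- (2 * \<kappa>)) ^ s"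
      using kappa exp_ge_add_one_self[of "- (2 * \<kappa>)"] by (intro power_mono) auto
    also have "\<dots> = exp (- (2 * (\<kappa> * s)))"
      by (simp add: exp_of_nat_mult[symmetric] mult_ac)
    also have "\<dots> \<le> exp (- (\<kappa> * s))" using kappa by simp
    also have "\<dots> \<le> 1 - \<kappa> * s / 2"
      using exp_minus_le_linear[of "\<kappa> * s"] kappa s by simp
    finally have e: "(1 - 2 * \<kappa>) ^ s \<le> 1 - \<kappa> * s / 2" .
    have "mean (\<lambda>x. ((step ^^ s) g x)\<^sup>2) \<le> t\<^sup>2 * (t / t\<^sup>2) powr ((1 - 2 * \<kappa>) ^ s)"
      using energy_decay[of g s] t b0 by (simp add: t_def)
    also have "\<dots> \<le> t\<^sup>2 * (1 / t) powr (1 - \<kappa> * s / 2)"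
      using t t1 by (simp add: power2_eq_square) (intro mult_left_mono powr_mono e, auto)
    also have "\<dots> = t powr 2 * t powr (- (1 - \<kappa> * s / 2))"
    proof -
      have "(1 / t) powr a = t powr (- a)" for a
        using t by (simp add: powr_minus powr_divide inverse_eq_divide)
      then show ?thesis using t by (simp only: powr_numeral)
    qed
    also have "\<dots> = t powr (1 + \<kappa> * real s / 2)"
      by (simp only: powr_add[symmetric]) (simp add: field_simps)
    finally show ?thesis by (simp add: t_def)
  qed
qed

text \<open>
  Nonempty sets cannot be arbitrarily small: the Dirichlet form is at most the energy, so Nash's
  inequality bounds \<open>ln (1/t)\<close>. This ensures that the number of steps chosen later in terms of \<open>t\<close> is
  at least one.
\<close>

lemma log_measure_bound:
  assumes g: "\<And>x. x \<in> X \<Longrightarrow> (g x)\<^sup>2 = \<bar>g x\<bar>" and t: "mean (\<lambda>x. \<bar>g x\<bar>) > 0"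
  shows "2 * \<kappa> * ln (1 / mean (\<lambda>x. \<bar>g x\<bar>)) \<le> 1"
proof -
  define t where "t = mean (\<lambda>x. \<bar>g x\<bar>)"
  have b0: "mean (\<lambda>x. (g x)\<^sup>2) = t" unfolding t_def by (intro mean_cong g)
  have t0: "t > 0" using assms(2) by (simp add: t_def)
  have "2 * \<kappa> * (t * ln (t / t\<^sup>2)) \<le> dirichlet g"
    using nash_inequality(2)[of g] b0 t0 by (simp add: t_def)
  also have "\<dots> \<le> t"
    using dirichlet_le_energy_drop[of g] b0 mean_nonneg[of "\<lambda>x. (step g x)\<^sup>2"] by simp
  finally have "t * (2 * \<kappa> * ln (1 / t)) \<le> t * 1"
    using t0 by (simp add: power2_eq_square mult_ac)
  then show ?thesis using t0 by (simp only: mult_le_cancel_left_pos t_def[symmetric])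
qed

definition variance :: "('x \<Rightarrow> real) \<Rightarrow> real" where
  "variance f = mean (\<lambda>x. (f x)\<^sup>2) - (mean f)\<^sup>2"

text \<open>
  Translation between a sign function and the indicator \<open>\<phi>\<close> of the set where it is positive.
\<close>

lemma sign_function_facts:
  assumes f: "\<And>x. x \<in> X \<Longrightarrow> f x = 1 \<or> f x = -1"
  defines "\<phi> \<equiv> \<lambda>x. (1 + f x) / 2"
  defines "t \<equiv> mean \<phi>"
  shows "\<And>x. x \<in> X \<Longrightarrow> (\<phi> x)\<^sup>2 = \<bar>\<phi> x\<bar>" and "mean (\<lambda>x. \<bar>\<phi> x\<bar>) = t"
    and "0 \<le> t" and "t \<le> 1" and "variance f = 4 * (t - t\<^sup>2)"
    and "mean (\<lambda>x. ((step ^^ s) f x)\<^sup>2) = 1 - 4 * (t - mean (\<lambda>x. ((step ^^ s) \<phi> x)\<^sup>2))"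
    and "mean (\<lambda>x. (f x)\<^sup>2) = 1"
proof -
  have p: "\<phi> x = 0 \<or> \<phi> x = 1" if "x \<in> X" for x using f[OF that] by (auto simp: \<phi>_def)
  show "(\<phi> x)\<^sup>2 = \<bar>\<phi> x\<bar>" if "x \<in> X" for x using p[OF that] by auto
  show abs: "mean (\<lambda>x. \<bar>\<phi> x\<bar>) = t" unfolding t_def using p by (intro mean_cong) fastforce
  show "0 \<le> t" unfolding t_def using p by (intro mean_nonneg) fastforce
  have "t \<le> mean (\<lambda>_. 1)" unfolding t_def using p by (intro mean_mono) fastforce
  then show "t \<le> 1" by simp
  have f2: "f = (\<lambda>x. 2 * \<phi> x + (-1))" by (auto simp: \<phi>_def field_simps)
  have mf: "mean f = 2 * t - 1" by (subst f2) (simp only: mean_add mean_scale mean_const t_def)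
  show one: "mean (\<lambda>x. (f x)\<^sup>2) = 1"
  proof -
    have "mean (\<lambda>x. (f x)\<^sup>2) = mean (\<lambda>_. 1)" using f by (intro mean_cong) fastforce
    then show ?thesis by simp
  qed
  have "variance f = 1 - (2 * t - 1)\<^sup>2" by (simp only: variance_def one mf)
  then show "variance f = 4 * (t - t\<^sup>2)" by (simp add: power2_eq_square algebra_simps)
  have mt: "mean ((step ^^ s) \<phi>) = t"
    by (induction s) (simp_all add: mean_step t_def)
  have aff: "(step ^^ s) f x = 2 * (step ^^ s) \<phi> x - 1" for x
    using arg_cong[where f = "\<lambda>h. (step ^^ s) h x", OF f2] step_pow_affine[of s 2 \<phi> "-1" x] by linarith
  have "mean (\<lambda>x. ((step ^^ s) f x)\<^sup>2)
     = mean (\<lambda>x. 4 * ((step ^^ s) \<phi> x)\<^sup>2 + (1 - 4 * (step ^^ s) \<phi> x))"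
    unfolding aff by (intro mean_cong) (simp add: power2_eq_square algebra_simps)
  also have "\<dots> = 4 * mean (\<lambda>x. ((step ^^ s) \<phi> x)\<^sup>2) + (1 - 4 * t)"
    by (simp only: mean_add mean_diff mean_scale mean_const mt)
  finally show "mean (\<lambda>x. ((step ^^ s) f x)\<^sup>2) = 1 - 4 * (t - mean (\<lambda>x. ((step ^^ s) \<phi> x)\<^sup>2))"
    by simp
qed

text \<open>
  After about \<open>1/\<kappa>\<close> steps the exponent in small-set expansion is at least \<open>5/4\<close>, and then at most
  three quarters of the variance of an indicator are left. For sign functions this spares a separate
  spectral gap estimate.
\<close>

lemma variance_le_energy_loss:
  assumes f: "\<And>x. x \<in> X \<Longrightarrow> f x = 1 \<or> f x = -1"
    and s: "\<kappa> * real s \<le> 1" "1 / 2 \<le> \<kappa> * real s"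
  shows "variance f \<le> 4 * (1 - mean (\<lambda>x. ((step ^^ s) f x)\<^sup>2))"
proof -
  define \<phi> where "\<phi> x = (1 + f x) / 2" for x
  define t where "t = mean \<phi>"
  note F = sign_function_facts[where f = f, OF f, folded \<phi>_def, folded t_def]
  have "mean (\<lambda>x. ((step ^^ s) \<phi> x)\<^sup>2) \<le> t powr (1 + \<kappa> * real s / 2)"
    using small_set_expansion[where g = \<phi>, OF F(1) s(1)] by (simp add: F(2))
  also have "\<dots> \<le> t powr (5/4)"
    using F(3,4) s(2) by (intro powr_mono') auto
  also have "\<dots> \<le> t\<^sup>2 + 3/4 * (t - t\<^sup>2)" by (rule powr_five_quarters_le[OF F(3,4)])
  finally have "t - t\<^sup>2 \<le> 4 * (t - mean (\<lambda>x. ((step ^^ s) \<phi> x)\<^sup>2))" by (simp add: field_simps)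
  moreover have "1 - mean (\<lambda>x. ((step ^^ s) f x)\<^sup>2) = 4 * (t - mean (\<lambda>x. ((step ^^ s) \<phi> x)\<^sup>2))"
    by (subst F(6)) simp_all
  ultimately show ?thesis by (subst F(5)) simp_all
qed

text \<open>
  With \<open>y = ln (1 / \<surd>t)\<close> the sum is \<open>t\<close> times a geometric series of ratio \<open>exp (-\<kappa>y)\<close> and at most
  \<open>1/\<kappa>\<close> terms. It is at most \<open>1/\<kappa>\<close> by the number of terms and of order \<open>1/(\<kappa>y)\<close> by its limit,
  where \<open>\<kappa>y \<le> 1/4\<close> keeps the first term from dominating.
\<close>

lemma geometric_sum_le:
  assumes t: "0 < t" "t \<le> 1" "2 * \<kappa> * ln (1 / t) \<le> 1" and N: "\<kappa> * real N \<le> 1"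
  shows "(\<Sum>s<N. t powr (1 + \<kappa> * real s / 2)) \<le> 5 / (2 * \<kappa>) * (t / (1 + ln (1 / sqrt t)))"
proof -
  define y where "y = ln (1 / sqrt t)"
  have y: "y = ln (1 / t) / 2" using t by (simp add: y_def ln_div ln_sqrt)
  have "0 \<le> ln (1 / t)" using t by (intro ln_ge_zero) simp
  then have y0: "0 \<le> y" by (simp add: y)
  have z: "\<kappa> * y \<le> 1 / 4" using t(3) by (simp add: y)
  define q where "q = exp (- (\<kappa> * y))"
  define S where "S = (\<Sum>s<N. q ^ s)"
  have q: "0 < q" "q \<le> 1" using kappa y0 by (auto simp: q_def)
  have S0: "0 \<le> S" unfolding S_def using q by (intro sum_nonneg) auto
  have "t powr (1 + \<kappa> * real s / 2) = t * q ^ s" for s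
  proof -
    have "t powr (\<kappa> * s / 2) = exp (- (\<kappa> * y) * s)"
      using t by (simp add: powr_def y ln_div)
    also have "\<dots> = q ^ s" by (simp add: q_def exp_of_nat_mult[symmetric] mult.commute)
    finally show ?thesis using t by (simp add: powr_add)
  qed
  then have eq: "(\<Sum>s<N. t powr (1 + \<kappa> * real s / 2)) = t * S"
    by (simp add: S_def sum_distrib_left)
  have "S \<le> (\<Sum>s<N. 1)" unfolding S_def using q by (intro sum_mono) (auto intro: power_le_one)
  then have "\<kappa> * S \<le> \<kappa> * real N" using kappa by (intro mult_left_mono) auto
  then have k1: "\<kappa> * S \<le> 1" using N by simp
  have "(1 - q) * S = 1 - q ^ N"
    unfolding S_def by (rule one_diff_power_eq[symmetric])
  then have qS: "(1 - q) * S \<le> 1" using q by simp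
  have ky: "0 \<le> \<kappa> * y" "0 < 1 + \<kappa> * y" using kappa y0 by (auto intro: add_pos_nonneg)
  have "\<kappa> * y \<le> (1 - q) * (1 + \<kappa> * y)"
    using one_minus_exp_ge[OF ky(1)] by (simp only: pos_divide_le_eq[OF ky(2)] q_def)
  then have "\<kappa> * y * S \<le> (1 - q) * (1 + \<kappa> * y) * S" using S0 by (rule mult_right_mono)
  also have "\<dots> = (1 + \<kappa> * y) * ((1 - q) * S)" by simp
  also have "\<dots> \<le> (1 + \<kappa> * y) * 1" using qS kappa y0 by (intro mult_left_mono) auto
  finally have "\<kappa> * (1 + y) * S \<le> 5 / 2" using k1 z by (simp add: algebra_simps)
  moreover have p: "0 < \<kappa> * (1 + y)" using kappa y0 by simp
  ultimately have "S \<le> (5 / 2) / (\<kappa> * (1 + y))" by (simp only: pos_le_divide_eq[OF p] mult.commute)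
  then have "S \<le> 5 / (2 * \<kappa>) / (1 + y)" by simp
  then have "t * S \<le> t * (5 / (2 * \<kappa>) / (1 + y))" using t by (intro mult_left_mono) auto
  then show ?thesis by (simp add: eq y_def[symmetric] mult_ac)
qed

text \<open>
  A constant fraction of the variance is lost during \<open>N\<close> steps, and each loss is an average over \<open>u\<close>
  of the energy of \<open>half_diff u (step\<^sup>s f) = step\<^sup>s (half_diff u f)\<close>. Since \<open>half_diff u f\<close> is a signed
  indicator of measure \<open>\<tau> u\<close>, small-set expansion applies to it.
\<close>

theorem talagrand_L1_L2:
  assumes f: "\<And>x. x \<in> X \<Longrightarrow> f x = 1 \<or> f x = -1"
  defines "\<tau> \<equiv> \<lambda>u. mean (\<lambda>x. \<bar>half_diff u f x\<bar>)"
  shows "variance f \<le> 20 / (\<kappa> * card U) * (\<Sum>u\<in>U. \<tau> u / (1 + ln (1 / sqrt (\<tau> u))))"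
proof -
  define N where "N = nat \<lfloor>1 / \<kappa>\<rfloor>"
  have "real N \<le> 1 / \<kappa>" "1 / \<kappa> < real N + 1"
    using kappa by (auto simp: N_def of_nat_nat)
  then have N: "\<kappa> * real N \<le> 1" "1 - \<kappa> < \<kappa> * real N"
    using kappa by (auto simp: field_simps)
  have bool: "(half_diff u f x)\<^sup>2 = \<bar>half_diff u f x\<bar>" if "u \<in> U" "x \<in> X" for u x
    using f[OF that(2)] f[OF act_in[OF that]] by (auto simp: half_diff_def)
  have each: "(\<Sum>s<N. mean (\<lambda>x. (half_diff u ((step ^^ s) f) x)\<^sup>2))
      \<le> 5 / (2 * \<kappa>) * (\<tau> u / (1 + ln (1 / sqrt (\<tau> u))))" if u: "u \<in> U" for u
  proof -
    have sse: "mean (\<lambda>x. (half_diff u ((step ^^ s) f) x)\<^sup>2) \<le> \<tau> u powr (1 + \<kappa> * real s / 2)"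
      if "s < N" for s
    proof -
      have "\<kappa> * s \<le> \<kappa> * N" using that kappa by (intro mult_left_mono) auto
      then have "\<kappa> * s \<le> 1" using N by linarith
      then show ?thesis
        using small_set_expansion[where g = "half_diff u f" and s = s, OF bool[OF u]] by (simp add: half_diff_step_pow[OF u] \<tau>_def)
    qed
    have "\<tau> u \<ge> 0" unfolding \<tau>_def by (intro mean_nonneg) simp
    show ?thesis
    proof (cases "\<tau> u = 0")
      case True
      then have "(\<Sum>s<N. mean (\<lambda>x. (half_diff u ((step ^^ s) f) x)\<^sup>2)) \<le> (\<Sum>s<N. 0)"
        using sse by (intro sum_mono) auto
      then show ?thesis using True by simp
    next
      case False
      with \<open>\<tau> u \<ge> 0\<close> have pos: "\<tau> u > 0" by simp
      have "\<bar>half_diff u f x\<bar> \<le> 1" if "x \<in> X" for x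
        using f[OF that] f[OF act_in[OF u that]] by (auto simp: half_diff_def)
      then have "\<tau> u \<le> mean (\<lambda>_. 1)" unfolding \<tau>_def by (intro mean_mono)
      then have le1: "\<tau> u \<le> 1" by simp
      have "2 * \<kappa> * ln (1 / \<tau> u) \<le> 1"
        using log_measure_bound[where g = "half_diff u f", OF bool[OF u]] pos by (simp add: \<tau>_def)
      then have "(\<Sum>s<N. \<tau> u powr (1 + \<kappa> * real s / 2)) \<le> 5 / (2 * \<kappa>) * (\<tau> u / (1 + ln (1 / sqrt (\<tau> u))))"
        by (rule geometric_sum_le[OF pos le1 _ N(1)])
      moreover have "(\<Sum>s<N. mean (\<lambda>x. (half_diff u ((step ^^ s) f) x)\<^sup>2)) \<le> (\<Sum>s<N. \<tau> u powr (1 + \<kappa> * real s / 2))"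
        using sse by (intro sum_mono) auto
      ultimately show ?thesis by linarith
    qed
  qed
  let ?e = "\<lambda>s. mean (\<lambda>x. ((step ^^ s) f x)\<^sup>2)"
  have "variance f \<le> 4 * (1 - ?e N)"
    using N kappa by (intro variance_le_energy_loss f) auto
  also have "1 - ?e N = (\<Sum>s<N. ?e s - ?e (Suc s))"
    using sign_function_facts(7)[where f = f, OF f] by (subst sum_lessThan_telescope') simp
  also have "\<dots> \<le> (\<Sum>s<N. 2 * dirichlet ((step ^^ s) f))"
    using energy_drop_le_dirichlet[of "(step ^^ s) f" for s] by (intro sum_mono) simp
  also have "\<dots> = 2 / card U * (\<Sum>s<N. \<Sum>u\<in>U. mean (\<lambda>x. (half_diff u ((step ^^ s) f) x)\<^sup>2))"
    by (simp add: dirichlet_sum sum_distrib_left sum_divide_distrib)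
  also have "(\<Sum>s<N. \<Sum>u\<in>U. mean (\<lambda>x. (half_diff u ((step ^^ s) f) x)\<^sup>2))
      = (\<Sum>u\<in>U. \<Sum>s<N. mean (\<lambda>x. (half_diff u ((step ^^ s) f) x)\<^sup>2))" by (rule sum.swap)
  also have "\<dots> \<le> (\<Sum>u\<in>U. 5 / (2 * \<kappa>) * (\<tau> u / (1 + ln (1 / sqrt (\<tau> u)))))"
    by (intro sum_mono each)
  finally have "variance f \<le> 4 * (2 / card U * (\<Sum>u\<in>U. 5 / (2 * \<kappa>) * (\<tau> u / (1 + ln (1 / sqrt (\<tau> u))))))"
    by (simp add: mult_left_mono divide_right_mono)
  also have "\<dots> = 20 / (\<kappa> * card U) * (\<Sum>u\<in>U. \<tau> u / (1 + ln (1 / sqrt (\<tau> u))))"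
    by (simp only: sum_distrib_left[symmetric]) simp
  finally show ?thesis .
qed

text \<open>
  Choose \<open>s\<close> of order \<open>1 / (\<kappa> (1 + ln (1/t)))\<close>. By small-set expansion a constant fraction of the
  mass \<open>t\<close> of the set \<open>{f = 1}\<close> has then left it, while \<open>displacement_le_gradient\<close> limits this
  displacement by \<open>\<surd>s\<close> times the mean gradient. The step count is doubled to \<open>s + s\<close> because
  \<open>E f R\<^bsup>2s\<^esup> f = E (R\<^sup>s f)\<^sup>2\<close>, with \<open>R\<close> the step of the walk.
\<close>

lemma surface_area_minority:
  assumes f: "\<And>x. x \<in> X \<Longrightarrow> f x = 1 \<or> f x = -1"
  defines "t \<equiv> mean (\<lambda>x. (1 + f x) / 2)"
  assumes t: "0 < t" "t \<le> 1 / 2"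
  shows "variance f / 32 * sqrt (\<kappa> * (1 + ln (1 / t))) \<le> mean (\<lambda>x. sqrt (gradsq f x))"
proof -
  define \<phi> where "\<phi> x = (1 + f x) / 2" for x
  note F = sign_function_facts[where f = f, OF f, folded \<phi>_def, folded t_def]
  have tp: "t = mean \<phi>" by (simp add: t_def \<phi>_def[abs_def])
  have F': "mean (\<lambda>x. \<bar>\<phi> x\<bar>) = t" "variance f = 4 * (t - t\<^sup>2)"
    "mean (\<lambda>x. ((step ^^ s) f x)\<^sup>2) = 1 - 4 * (t - mean (\<lambda>x. ((step ^^ s) \<phi> x)\<^sup>2))" for s
    using sign_function_facts(2,5,6)[where f = f, OF f] by (simp_all add: \<phi>_def[abs_def] t_def)
  define l where "l = ln (1 / t)"
  have "ln 2 \<le> l" unfolding l_def using t by (intro ln_mono) (auto simp: field_simps)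
  then have l: "2/3 \<le> l" using ln2_ge_two_thirds by linarith
  define A where "A = 1 + l"
  have A: "A > 0" using l by (simp add: A_def)
  have "2 * \<kappa> * l \<le> 1" using log_measure_bound[where g = \<phi>, OF F(1)] t by (simp add: F'(1) l_def)
  then have kA: "\<kappa> * A \<le> 1" using kappa by (simp add: A_def algebra_simps)
  define s where "s = nat \<lfloor>1 / (\<kappa> * A)\<rfloor>"
  have kA0: "\<kappa> * A > 0" using kappa A by simp
  then have "1 \<le> 1 / (\<kappa> * A)" using kA by simp
  moreover from this have "real s = of_int \<lfloor>1 / (\<kappa> * A)\<rfloor>" unfolding s_def using kA0 by (intro of_nat_nat) simp
  ultimately have s: "real s \<le> 1 / (\<kappa> * A)" "1 / (\<kappa> * A) < real s + 1" "1 \<le> s"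
    by linarith+
  have s1: "\<kappa> * A * real s \<le> 1" using s(1) kA0 by (simp add: field_simps)
  have "1 / (\<kappa> * A) \<le> 2 * real s" using s(2,3) by linarith
  then have s2: "1 / 2 \<le> \<kappa> * A * real s" using kA0 by (simp add: field_simps)
  have "\<kappa> * s * 1 \<le> \<kappa> * s * A" using l kappa by (intro mult_left_mono) (auto simp: A_def)
  then have ks: "\<kappa> * s \<le> 1" using s1 by (simp add: mult_ac)
  define z where "z = \<kappa> * s * l / 2"
  have z: "1 / 10 \<le> z"
  proof -
    have "2 / 5 * A \<le> l" using l by (simp add: A_def)
    then have "\<kappa> * s / 2 * (2 / 5 * A) \<le> \<kappa> * s / 2 * l" using kappa by (intro mult_left_mono) auto
    then show ?thesis using s2 by (simp add: z_def mult_ac)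
  qed
  have "1 / 11 \<le> z / (1 + z)" using z by (simp add: field_simps)
  also have "\<dots> \<le> 1 - exp (- z)" using z by (intro one_minus_exp_ge) simp
  finally have ez: "exp (- z) \<le> 10 / 11" by simp
  have "mean (\<lambda>x. ((step ^^ s) \<phi> x)\<^sup>2) \<le> t powr (1 + \<kappa> * real s / 2)"
    using small_set_expansion[where g = \<phi>, OF F(1) ks] by (simp add: F'(1))
  also have "\<dots> = t powr 1 * t powr (\<kappa> * real s / 2)" by (rule powr_add)
  also have "\<dots> = t * exp (- z)"
    using t by (simp add: powr_def[of t "\<kappa> * real s / 2"] z_def l_def ln_div)
  also have "\<dots> \<le> t * (10 / 11)" using t ez by (intro mult_left_mono) auto
  finally have b: "mean (\<lambda>x. ((step ^^ s) \<phi> x)\<^sup>2) \<le> t * (10 / 11)" .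
  let ?M = "mean (\<lambda>x. sqrt (gradsq f x))"
  have f1: "\<bar>f x\<bar> \<le> 1" if "x \<in> X" for x using f[OF that] by auto
  have "mean (\<lambda>x. f x * (step ^^ (s + s)) f x) = mean (\<lambda>x. ((step ^^ s) f x)\<^sup>2)"
    using mean_mult_step_pow[of f s "(step ^^ s) f"] by (simp add: funpow_add power2_eq_square)
  moreover have "mean (\<lambda>x. f x * f x) = 1" using sign_function_facts(7)[where f = f, OF f] by (simp add: power2_eq_square)
  ultimately have "4 * (t - mean (\<lambda>x. ((step ^^ s) \<phi> x)\<^sup>2)) \<le> 2 * sqrt (real (s + s)) * ?M"
    using displacement_le_gradient[where g = f and f = f and N = "s + s", OF f1] by (simp add: F'(3))
  then have main: "4 * t / 11 \<le> 2 * sqrt (real (s + s)) * ?M" using b by simp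
  have M0: "0 \<le> ?M" by (intro mean_nonneg) (simp add: gradsq_nonneg)
  have "sqrt (real (s + s)) * sqrt (\<kappa> * A) = sqrt (2 * (\<kappa> * A * s))"
    by (simp add: real_sqrt_mult[symmetric] mult_ac)
  also have "\<dots> \<le> sqrt 2" using s1 by simp
  also have "\<dots> \<le> 16 / 11" by (rule real_le_lsqrt) (auto simp: power2_eq_square)
  finally have sq: "sqrt (real (s + s)) * sqrt (\<kappa> * A) \<le> 16 / 11" .
  have "4 * t / 11 * sqrt (\<kappa> * A) \<le> 2 * sqrt (real (s + s)) * ?M * sqrt (\<kappa> * A)"
    using main kA0 by (intro mult_right_mono) auto
  also have "\<dots> = 2 * ?M * (sqrt (real (s + s)) * sqrt (\<kappa> * A))" by simp
  also have "\<dots> \<le> 2 * ?M * (16 / 11)" using sq M0 by (intro mult_left_mono) auto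
  finally have fin: "4 * t * sqrt (\<kappa> * A) \<le> 32 * ?M" by simp
  have "variance f * sqrt (\<kappa> * A) \<le> 4 * t * sqrt (\<kappa> * A)"
    using kA0 by (intro mult_right_mono) (auto simp: F'(2))
  then show ?thesis using fin by (simp add: A_def l_def)
qed

text \<open>
  Both sides are invariant under \<open>f \<mapsto> -f\<close>, so \<open>{f = 1}\<close> may be taken to be the minority. Then its
  measure \<open>t\<close> satisfies \<open>t \<le> variance f\<close>.
\<close>

theorem talagrand_surface_area:
  assumes f: "\<And>x. x \<in> X \<Longrightarrow> f x = 1 \<or> f x = -1" and v: "variance f > 0"
  shows "variance f / 32 * sqrt (\<kappa> * ln (exp 1 / variance f)) \<le> mean (\<lambda>x. sqrt (gradsq f x))"
proof -
  have key: "variance g / 32 * sqrt (\<kappa> * ln (exp 1 / variance g)) \<le> mean (\<lambda>x. sqrt (gradsq g x))"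
    if g: "\<And>x. x \<in> X \<Longrightarrow> g x = 1 \<or> g x = -1" and vg: "variance g > 0"
      and t: "mean (\<lambda>x. (1 + g x) / 2) \<le> 1 / 2" for g
  proof -
    define t where "t = mean (\<lambda>x. (1 + g x) / 2)"
    have F: "0 \<le> t" "variance g = 4 * (t - t\<^sup>2)"
      using sign_function_facts(3,5)[where f = g, OF g] by (simp_all add: t_def)
    then have t0: "t > 0" using vg by (cases "t = 0") auto
    have "2 * t\<^sup>2 \<le> t" using t t0 by (simp add: t_def[symmetric] power2_eq_square)
    then have tv: "t \<le> variance g" using F t0 by simp
    have "ln (exp 1 / variance g) = 1 + ln (1 / variance g)" using vg by (simp add: ln_div)
    also have "\<dots> \<le> 1 + ln (1 / t)"
      using tv t0 vg by (simp add: ln_div)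
    finally have "\<kappa> * ln (exp 1 / variance g) \<le> \<kappa> * (1 + ln (1 / t))"
      using kappa by (intro mult_left_mono) auto
    then have "variance g / 32 * sqrt (\<kappa> * ln (exp 1 / variance g))
        \<le> variance g / 32 * sqrt (\<kappa> * (1 + ln (1 / t)))"
      using vg by (intro mult_left_mono) auto
    also have "\<dots> \<le> mean (\<lambda>x. sqrt (gradsq g x))"
      using surface_area_minority[where f = g, OF g] t t0 by (simp add: t_def)
    finally show ?thesis .
  qed
  show ?thesis
  proof (cases "mean (\<lambda>x. (1 + f x) / 2) \<le> 1 / 2")
    case True
    then show ?thesis using key f v by blast
  next
    case False
    let ?g = "\<lambda>x. (-1) * f x"
    have mg: "mean ?g = - mean f" using mean_scale[of "-1" f] by simp
    have "mean (\<lambda>x. (1 + ?g x) / 2) = (1 - mean f) / 2" "mean (\<lambda>x. (1 + f x) / 2) = (1 + mean f) / 2"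
      by (simp_all add: mean_divide mean_add mean_diff)
    then have "mean (\<lambda>x. (1 + ?g x) / 2) \<le> 1 / 2" using False by (simp add: field_simps)
    moreover have vg: "variance ?g = variance f" using mg by (simp add: variance_def)
    moreover have "gradsq ?g = gradsq f"
      by (auto simp: gradsq_def half_diff_def power2_eq_square field_simps intro!: sum.cong)
    moreover have "?g x = 1 \<or> ?g x = -1" if "x \<in> X" for x using f[OF that] by auto
    ultimately show ?thesis using key[of ?g] v by simp
  qed
qed

end

section \<open>The slice with the action of the transpositions\<close>

lemma slice_eq_ksets: "slice n k = ksets {1..n} k"
  by (simp add: slice_def ksets_def)

lemma finite_transpositions: "finite (transpositions n)"
  and card_transpositions_le: "card (transpositions n) \<le> n\<^sup>2"
proof -
  have sub: "transpositions n \<subseteq> (\<lambda>(i,j). Transposition.transpose i j) ` ({1..n} \<times> {1..n})"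
    by (force simp: transpositions_def)
  then show "finite (transpositions n)" by (rule finite_subset) auto
  have "card (transpositions n) \<le> card ({1..n} \<times> {1..n})"
    using card_mono[OF _ sub] card_image_le[of "{1..n} \<times> {1..n}" "\<lambda>(i,j). Transposition.transpose i j"] by force
  then show "card (transpositions n) \<le> n\<^sup>2" by (simp add: card_cartesian_product power2_eq_square)
qed

lemma transpose_in_transpositions:
  assumes "i \<in> {1..n}" "j \<in> {1..n}" "i \<noteq> j"
  shows "Transposition.transpose i j \<in> transpositions n"
  using assms by (cases i j rule: linorder_cases) (auto simp: transpositions_def intro: transpose_commute)

text \<open>
  A transposition that moves \<open>x\<close> determines which of its two points lies in \<open>x\<close>.
\<close>

lemma inj_on_transpose_boundary: "inj_on (\<lambda>(a,b). Transposition.transpose a b) (x \<times> - x)"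
proof (rule inj_onI, clarify)
  fix a b c d assume *: "a \<in> x" "b \<notin> x" "c \<in> x" "d \<notin> x"
    and eq: "Transposition.transpose a b = Transposition.transpose c d"
  have "Transposition.transpose c d a = b" using fun_cong[OF eq, of a] by simp
  with * show "a = c \<and> b = d" by (auto simp: Transposition.transpose_def split: if_splits)
qed

lemma sum_boundary_le_sum_transpositions:
  fixes F :: "(nat \<Rightarrow> nat) \<Rightarrow> real"
  assumes "x \<subseteq> {1..n}" "\<And>u. 0 \<le> F u"
  shows "(\<Sum>a\<in>x. \<Sum>b\<in>{1..n} - x. F (Transposition.transpose a b)) \<le> (\<Sum>u\<in>transpositions n. F u)"
proof -
  let ?P = "x \<times> ({1..n} - x)" and ?t = "\<lambda>(a,b). Transposition.transpose a b"
  have "finite x" using assms(1) by (rule finite_subset) simp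
  then have "(\<Sum>a\<in>x. \<Sum>b\<in>{1..n} - x. F (Transposition.transpose a b)) = (\<Sum>p\<in>?P. F (?t p))"
    by (simp add: sum.cartesian_product case_prod_beta)
  also have "\<dots> = (\<Sum>u\<in>?t ` ?P. F u)"
    by (subst sum.reindex) (auto intro: inj_on_subset[OF inj_on_transpose_boundary])
  also have "\<dots> \<le> (\<Sum>u\<in>transpositions n. F u)"
    using assms by (intro sum_mono2 finite_transpositions) (auto intro!: transpose_in_transpositions)
  finally show ?thesis .
qed

text \<open>
  Closure under conjugation: \<open>u\<close> conjugates the transposition of \<open>a\<close> and \<open>b\<close> to that of \<open>u a\<close> and
  \<open>u b\<close>.
\<close>

lemma slice_involution_walk:
  assumes "2 \<le> n" "k \<le> n"
  shows "involution_walk (slice n k) (transpositions n) (`)"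
proof
  show "finite (slice n k)" by (simp add: slice_eq_ksets)
  have "card (slice n k) \<noteq> 0" using assms by (simp add: slice_eq_ksets card_ksets)
  then show "slice n k \<noteq> {}" by auto
  show "finite (transpositions n)" by (rule finite_transpositions)
  show "transpositions n \<noteq> {}" using transpose_in_transpositions[of 1 n 2] assms by auto
  fix u assume u: "u \<in> transpositions n"
  then obtain i j where ij: "u = Transposition.transpose i j" "1 \<le> i" "i < j" "j \<le> n"
    by (auto simp: transpositions_def)
  show "u ` x \<in> slice n k" if "x \<in> slice n k" for x
    using that ij by (auto simp: slice_eq_ksets intro!: transpose_image_ksets)
  show "u ` u ` x = x" for x using ij by simp
  show "u \<circ> u = id" using ij by (simp add: fun_eq_iff)
  show "u \<circ> v \<circ> u \<in> transpositions n" if "v \<in> transpositions n" for v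
  proof -
    from that obtain a b where ab: "v = Transposition.transpose a b" "1 \<le> a" "a < b" "b \<le> n"
      by (auto simp: transpositions_def)
    have inv: "inj u" "\<And>y. u (u y) = y" using ij by auto
    have "u \<circ> v \<circ> u = Transposition.transpose (u a) (u b)"
    proof
      fix y
      show "(u \<circ> v \<circ> u) y = Transposition.transpose (u a) (u b) y"
        using inv(2) unfolding ab(1) by (simp add: Transposition.transpose_def) (metis inv(2))
    qed
    moreover have "u a \<in> {1..n}" "u b \<in> {1..n}" "u a \<noteq> u b"
      using ij ab inv(1) by (auto simp: Transposition.transpose_def inj_eq)
    ultimately show ?thesis by (simp add: transpose_in_transpositions)
  qed
qed (simp add: image_comp)

locale balanced_slice =
  fixes \<eta> :: real and n k :: nat
  assumes eta: "0 < \<eta>" "\<eta> \<le> 1 / 2" and n: "2 \<le> n"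
    and balanced: "\<eta> * n \<le> k" "\<eta> * n \<le> real n - k"
begin

lemma k_le_n: "k \<le> n"
proof -
  have "0 \<le> \<eta> * n" using eta by simp
  then have "real k \<le> real n" using balanced by linarith
  then show ?thesis by simp
qed

lemma boundary_size: "\<eta> / 2 * (real n)\<^sup>2 \<le> real k * (real n - real k)"
proof (cases "real k \<le> real n / 2")
  case True
  have "(\<eta> * n) * (n / 2) \<le> real k * (real n - real k)"
    using True balanced eta by (intro mult_mono) auto
  then show ?thesis by (simp add: power2_eq_square)
next
  case False
  have "(n / 2) * (\<eta> * n) \<le> real k * (real n - real k)"
    using False balanced eta by (intro mult_mono) auto
  then show ?thesis by (simp add: power2_eq_square mult_ac)
qed

sublocale involution_walk "slice n k" "transpositions n" "(`)"
  by (rule slice_involution_walk[OF n k_le_n])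

text \<open>
  The transpositions that move one fixed \<open>k\<close>-set are already numerous enough.
\<close>

lemma card_transpositions_ge: "\<eta> / 2 * (real n)\<^sup>2 \<le> card (transpositions n)"
proof -
  have "(\<Sum>a\<in>{1..k}. \<Sum>b\<in>{1..n} - {1..k}. 1) \<le> (\<Sum>u\<in>transpositions n. 1 :: real)"
    using k_le_n by (intro sum_boundary_le_sum_transpositions[where F = "\<lambda>_. 1"]) auto
  then have "real k * (real n - real k) \<le> card (transpositions n)"
    using k_le_n by (simp add: card_Diff_subset of_nat_diff)
  then show ?thesis using boundary_size by linarith
qed

lemma flow_le_dirichlet:
  "flow {1..n} k g \<le> 4 * real (card (slice n k)) * real (card (transpositions n)) * dirichlet g"
proof -
  have "flow {1..n} k g \<le> (\<Sum>x\<in>slice n k. \<Sum>u\<in>transpositions n. (g x - g (u ` x))\<^sup>2)"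
    unfolding flow_def slice_eq_ksets[symmetric]
    by (intro sum_mono sum_boundary_le_sum_transpositions[where F = "\<lambda>u. (g x - g (u ` x))\<^sup>2" for x])
      (auto simp: slice_def)
  also have "\<dots> = (\<Sum>x\<in>slice n k. 4 * real (card (transpositions n)) * gradsq g x)"
  proof (rule sum.cong[OF refl])
    fix x
    have "(g x - g (u ` x))\<^sup>2 = 4 * (half_diff u g x)\<^sup>2" for u
      by (simp add: half_diff_def power_divide power2_commute)
    then show "(\<Sum>u\<in>transpositions n. (g x - g (u ` x))\<^sup>2) = 4 * real (card (transpositions n)) * gradsq g x"
      using card_U_pos by (simp only: gradsq_def sum_distrib_left[symmetric]) simp
  qed
  also have "\<dots> = 4 * real (card (slice n k)) * real (card (transpositions n)) * dirichlet g"
    using card_X_pos by (simp add: dirichlet_def mean_def sum_distrib_left[symmetric])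
  finally show ?thesis .
qed

text \<open>
  Changing normalisations in \<open>slice_log_sobolev\<close>: the flow is at most \<open>4 card X card U\<close> times the
  Dirichlet form, \<open>card U \<le> n\<^sup>2\<close>, and \<open>k (n - k)\<close> is at least \<open>\<eta> n\<^sup>2 / 2\<close>. The entropy is thus at most
  \<open>32 n / \<eta>\<close> times the Dirichlet form, and \<open>2 \<kappa>\<close> is the inverse of this constant.
\<close>

sublocale log_sobolev_walk "slice n k" "transpositions n" "(`)" "\<eta> / (64 * n)"
proof
  show "0 < \<eta> / (64 * n)" using eta n by simp
  show "\<eta> / (64 * n) \<le> 1 / 2" using eta n by (simp add: field_simps)
  fix g :: "nat set \<Rightarrow> real"
  let ?X = "slice n k" and ?U = "real (card (transpositions n))"
  define Ent where "Ent = mean (\<lambda>x. (g x)\<^sup>2 * ln ((g x)\<^sup>2)) - mean (\<lambda>x. (g x)\<^sup>2) * ln (mean (\<lambda>x. (g x)\<^sup>2))"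
  have X: "real (card ?X) > 0" by (rule card_X_pos)
  have kl: "0 < real k * (real n - real k)"
    using boundary_size eta n by (smt (verit) divide_pos_pos mult_pos_pos of_nat_0_less_iff zero_less_power less_le_trans zero_less_numeral pos2)
  have "card ?X * Ent = ent ?X (\<lambda>x. (g x)\<^sup>2)"
    using X by (simp add: Ent_def ent_def mean_def field_simps)
  also have "\<dots> \<le> 4 * (k + (n - k)) / (k * (n - k)) * flow {1..n} k g"
    unfolding slice_eq_ksets using k_le_n slice_log_sobolev[of "{1..n}" k "n - k" g] by simp
  also have "\<dots> = 4 * n / (real k * (real n - real k)) * flow {1..n} k g"
    using k_le_n by (simp add: of_nat_diff)
  also have "\<dots> \<le> 4 * n / (real k * (real n - real k)) * (4 * real (card ?X) * ?U * dirichlet g)"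
    using kl by (intro mult_left_mono flow_le_dirichlet) auto
  also have "\<dots> = card ?X * (16 * n * ?U / (real k * (real n - real k)) * dirichlet g)" by simp
  finally have "Ent \<le> 16 * n * ?U / (real k * (real n - real k)) * dirichlet g"
    by (simp only: mult_le_cancel_left_pos[OF X])
  also have "\<dots> \<le> 16 * n * (real n)\<^sup>2 / (\<eta> / 2 * (real n)\<^sup>2) * dirichlet g"
  proof (intro mult_right_mono frac_le)
    show "16 * n * ?U \<le> 16 * n * (real n)\<^sup>2"
      using card_transpositions_le[of n] by (intro mult_left_mono) (auto simp flip: of_nat_power)
  qed (use eta n boundary_size dirichlet_nonneg in auto)
  also have "\<dots> = 32 * n / \<eta> * dirichlet g" using eta n by simp
  finally have "\<eta> / (32 * n) * Ent \<le> \<eta> / (32 * n) * (32 * n / \<eta> * dirichlet g)"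
    using eta by (intro mult_left_mono) auto
  also have "\<dots> = dirichlet g" using eta n by simp
  finally show "2 * (\<eta> / (64 * n)) * (mean (\<lambda>x. (g x)\<^sup>2 * ln ((g x)\<^sup>2))
      - mean (\<lambda>x. (g x)\<^sup>2) * ln (mean (\<lambda>x. (g x)\<^sup>2))) \<le> dirichlet g"
    by (simp add: Ent_def[symmetric])
qed

end

section \<open>Boolean functions on the slice\<close>

locale boolean_on_slice = balanced_slice +
  fixes f :: "nat set \<Rightarrow> real"
  assumes f: "x \<in> slice n k \<Longrightarrow> f x = 1 \<or> f x = -1"
begin

abbreviation "\<mu> \<equiv> unif_slice n k"
abbreviation "U \<equiv> transpositions n"
abbreviation "infl u \<equiv> Infl \<mu> u f"

lemma expectation_eq_mean: "measure_pmf.expectation \<mu> g = mean g"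
  unfolding unif_slice_def mean_def using finite_X X_nonempty by (simp add: integral_pmf_of_set)

lemma Varf_eq: "Varf \<mu> f = variance f"
  by (simp add: Varf_def variance_def expectation_eq_mean)

lemma Ldiff_eq: "Ldiff u f = half_diff u f"
  by (simp add: fun_eq_iff Ldiff_def half_diff_def)

lemma abs_half_diff:
  assumes "u \<in> U" "x \<in> slice n k"
  shows "\<bar>half_diff u f x\<bar> = (if f x \<noteq> f (u ` x) then 1 else 0)"
  using f[OF assms(2)] f[OF act_in[OF assms]] by (auto simp: half_diff_def)

lemma Infl_eq: "u \<in> U \<Longrightarrow> infl u = mean (\<lambda>x. \<bar>half_diff u f x\<bar>)"
proof -
  assume u: "u \<in> U"
  have "infl u = real (card (slice n k \<inter> {x. f x \<noteq> f (u ` x)})) / card (slice n k)"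
    unfolding Infl_def unif_slice_def using finite_X X_nonempty by (simp add: measure_pmf_of_set)
  also have "real (card (slice n k \<inter> {x. f x \<noteq> f (u ` x)})) = (\<Sum>x\<in>slice n k. if f x \<noteq> f (u ` x) then 1 else 0)"
    using finite_X by (simp add: sum.If_cases)
  also have "\<dots> = (\<Sum>x\<in>slice n k. \<bar>half_diff u f x\<bar>)"
    using u by (intro sum.cong refl) (simp add: abs_half_diff)
  finally show ?thesis by (simp add: mean_def)
qed

lemma infl_bounds: "0 \<le> infl u" "infl u \<le> 1"
  by (simp_all add: Infl_def)

lemma pnorm_Ldiff:
  assumes "u \<in> U"
  shows "pnorm \<mu> 2 (Ldiff u f) = sqrt (infl u)" and "pnorm \<mu> 1 (Ldiff u f) = infl u"
proof -
  have m: "mean (\<lambda>x. \<bar>half_diff u f x\<bar> powr p) = infl u" for p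
    unfolding Infl_eq[OF assms] using assms by (intro mean_cong) (simp add: abs_half_diff)
  show "pnorm \<mu> 2 (Ldiff u f) = sqrt (infl u)" "pnorm \<mu> 1 (Ldiff u f) = infl u"
    unfolding pnorm_def expectation_eq_mean Ldiff_eq m using infl_bounds[of u]
    by (simp_all add: powr_half_sqrt)
qed

lemma SA_eq: "SA \<mu> U f = sqrt (card U) * mean (\<lambda>x. sqrt (gradsq f x))"
proof -
  have "sqrt (real (sens U f x)) = sqrt (card U) * sqrt (gradsq f x)" if x: "x \<in> slice n k" for x
  proof -
    have "real (sens U f x) = (\<Sum>u\<in>U. if f x \<noteq> f (u ` x) then 1 else 0)"
      using finite_U by (simp add: sens_def sum.If_cases Int_def eq_commute)
    also have "\<dots> = (\<Sum>u\<in>U. (half_diff u f x)\<^sup>2)"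
    proof (rule sum.cong[OF refl])
      fix u assume "u \<in> U"
      then have "\<bar>half_diff u f x\<bar>\<^sup>2 = (if f x \<noteq> f (u ` x) then 1 else 0)"
        using x by (simp only: abs_half_diff) simp
      then show "(if f x \<noteq> f (u ` x) then 1 else 0) = (half_diff u f x)\<^sup>2" by simp
    qed
    also have "\<dots> = card U * gradsq f x" using card_U_pos by (simp add: gradsq_def)
    finally show ?thesis by (simp add: real_sqrt_mult)
  qed
  then show ?thesis
    unfolding SA_def expectation_eq_mean mean_scale[symmetric] by (intro mean_cong)
qed

lemma variance_bounds: "0 \<le> variance f" "variance f \<le> 1"
proof -
  define t where "t = mean (\<lambda>x. (1 + f x) / 2)"
  have v: "variance f = 4 * (t - t\<^sup>2)" and t: "0 \<le> t" "t \<le> 1"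
    using sign_function_facts(3,4,5)[where f = f, OF f] by (simp_all add: t_def)
  have "t\<^sup>2 \<le> t * 1" using t by (simp only: power2_eq_square mult_left_mono)
  then show "0 \<le> variance f" by (simp add: v)
  have "0 \<le> (2 * t - 1)\<^sup>2" by simp
  then show "variance f \<le> 1" unfolding v by (simp add: power2_eq_square algebra_simps)
qed

text \<open>
  For \<open>infl u = 0\<close> both \<open>1 / 0\<close> and \<open>ln 0\<close> are \<open>0\<close>, which makes the denominator \<open>1\<close> and the
  quotient \<open>0\<close>, in accordance with the convention for summands of zero influence.
\<close>

lemma log_denominator_pos: "0 < 1 + ln (1 / sqrt (infl u))"
proof (cases "infl u = 0")
  case False
  then have "0 < sqrt (infl u)" "sqrt (infl u) \<le> 1" using infl_bounds[of u] by auto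
  then have "0 \<le> ln (1 / sqrt (infl u))" by (intro ln_ge_zero) simp
  then show ?thesis by simp
qed simp

lemma influence_sum_ge_variance:
  "\<eta>\<^sup>2 / 2560 * variance f \<le> 1 / n * (\<Sum>u\<in>U. infl u / (1 + ln (1 / sqrt (infl u))))"
proof -
  let ?S = "\<Sum>u\<in>U. infl u / (1 + ln (1 / sqrt (infl u)))"
  have S0: "0 \<le> ?S"
    using infl_bounds log_denominator_pos by (intro sum_nonneg divide_nonneg_pos) auto
  have "variance f \<le> 20 / (\<eta> / (64 * n) * card U) * ?S"
    using talagrand_L1_L2[OF f] by (simp add: Infl_eq)
  also have "\<dots> \<le> 20 / (\<eta> / (64 * n) * (\<eta> / 2 * (real n)\<^sup>2)) * ?S"
    using eta n card_transpositions_ge card_U_pos S0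
    by (intro mult_right_mono divide_left_mono mult_left_mono mult_pos_pos) auto
  also have "20 / (\<eta> / (64 * n) * (\<eta> / 2 * (real n)\<^sup>2)) = 2560 / \<eta>\<^sup>2 * (1 / n)"
    using eta n by (simp add: power2_eq_square)
  finally have "\<eta>\<^sup>2 / 2560 * variance f \<le> \<eta>\<^sup>2 / 2560 * (2560 / \<eta>\<^sup>2 * (1 / n) * ?S)"
    by (intro mult_left_mono) auto
  then show ?thesis using eta by simp
qed

text \<open>
  If some influence reaches \<open>1/\<surd>n\<close>, it is large enough because \<open>ln n \<le> 2 \<surd>n\<close>. Otherwise every
  denominator in \<open>talagrand_L1_L2\<close> is at least \<open>ln n / 4\<close>, and there are \<open>card U\<close> summands.
\<close>

lemma max_influence_ge:
  "\<eta> / 5120 * (ln n / n) * variance f \<le> Max (infl ` U)"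
proof -
  define M where "M = Max (infl ` U)"
  have le: "infl u \<le> M" if "u \<in> U" for u
    unfolding M_def using that finite_U by (intro Max_ge) auto
  obtain u0 where "u0 \<in> U" using U_nonempty by auto
  then have M0: "0 \<le> M" using le[of u0] infl_bounds(1)[of u0] by linarith
  have ln0: "0 < ln n" using n by simp
  show ?thesis
  proof (cases "M < 1 / sqrt n")
    case False
    have "ln (sqrt n) \<le> sqrt n - 1" using n by (intro ln_le_minus_one) simp
    then have "ln n \<le> 2 * sqrt n" using n by (simp add: ln_sqrt)
    then have "ln n / n \<le> 2 * sqrt n / n" by (intro divide_right_mono) auto
    also have "\<dots> = 2 / sqrt n" using n by (simp add: field_simps)
    finally have "\<eta> / 5120 * (ln n / n) * variance f \<le> (1 / 2) * (2 / sqrt n) * 1"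
      using eta ln0 variance_bounds by (intro mult_mono) auto
    then show ?thesis using False by (simp add: M_def)
  next
    case True
    have each: "infl u / (1 + ln (1 / sqrt (infl u))) \<le> 4 * M / ln n" if u: "u \<in> U" for u
    proof (cases "infl u = 0")
      case False
      then have p: "0 < infl u" using infl_bounds(1)[of u] by simp
      have "infl u < 1 / sqrt n" using le[OF u] True by simp
      then have "ln (infl u) \<le> ln (1 / sqrt n)" using p by (intro ln_mono) auto
      then have "ln n / 4 \<le> 1 + ln (1 / sqrt (infl u))"
        using n p by (simp add: ln_div ln_sqrt)
      then have "infl u / (1 + ln (1 / sqrt (infl u))) \<le> M / (ln n / 4)"
        using le[OF u] p ln0 by (intro frac_le) auto
      then show ?thesis by (simp add: mult.commute)
    qed (use M0 ln0 in simp)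
    have "variance f \<le> 20 / (\<eta> / (64 * n) * card U) * (\<Sum>u\<in>U. infl u / (1 + ln (1 / sqrt (infl u))))"
      using talagrand_L1_L2[OF f] by (simp add: Infl_eq)
    also have "\<dots> \<le> 20 / (\<eta> / (64 * n) * card U) * (\<Sum>u\<in>U. 4 * M / ln n)"
      using eta by (intro mult_left_mono sum_mono each) auto
    also have "\<dots> = 5120 * n / (\<eta> * ln n) * M"
      using eta n card_U_pos by simp
    finally have "\<eta> / 5120 * (ln n / n) * variance f
        \<le> \<eta> / 5120 * (ln n / n) * (5120 * n / (\<eta> * ln n) * M)"
      using eta ln0 by (intro mult_left_mono) auto
    also have "\<dots> = M" using eta n ln0 by simp
    finally show ?thesis by (simp add: M_def)
  qed
qed

lemma surface_area_ge:
  assumes "variance f \<noteq> 0"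
  shows "\<eta> / 384 * sqrt n * variance f * sqrt (ln (exp 1 / variance f)) \<le> SA \<mu> U f"
proof -
  let ?v = "variance f" and ?l = "ln (exp 1 / variance f)"
  have v: "0 < ?v" using assms variance_bounds by simp
  have "ln ?v \<le> 0" using v variance_bounds by simp
  moreover have "?l = 1 - ln ?v" using v by (simp add: ln_div)
  ultimately have l0: "0 \<le> ?l" by linarith
  \<comment> \<open>\<open>12\<^sup>2 \<ge> 128\<close>, and \<open>128 = 2 \<cdot> 64\<close> comes from the bound on the number of transpositions and from
    the constant \<open>\<kappa> = \<eta> / (64 n)\<close>\<close>
  have "\<eta> / 12 * sqrt n \<le> sqrt (card U * (\<eta> / (64 * n)))"
  proof (rule real_le_rsqrt)
    have "(\<eta> / 12 * sqrt n)\<^sup>2 = \<eta>\<^sup>2 * n / 144" by (simp add: power_mult_distrib power_divide)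
    also have "\<dots> \<le> \<eta>\<^sup>2 * n / 128" by (intro divide_left_mono) auto
    also have "\<dots> = \<eta> / 2 * (real n)\<^sup>2 * (\<eta> / (64 * n))" using n by (simp add: power2_eq_square)
    also have "\<dots> \<le> card U * (\<eta> / (64 * n))"
      using eta by (intro mult_right_mono card_transpositions_ge) auto
    finally show "(\<eta> / 12 * sqrt n)\<^sup>2 \<le> card U * (\<eta> / (64 * n))" .
  qed
  then have "\<eta> / 12 * sqrt n * (?v / 32 * sqrt ?l) \<le> sqrt (card U * (\<eta> / (64 * n))) * (?v / 32 * sqrt ?l)"
    using v l0 by (intro mult_right_mono) auto
  also have "\<dots> = sqrt (card U) * (?v / 32 * sqrt (\<eta> / (64 * n) * ?l))"
    by (simp only: real_sqrt_mult mult_ac)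
  also have "\<dots> \<le> sqrt (card U) * mean (\<lambda>x. sqrt (gradsq f x))"
    using talagrand_surface_area[OF f v] by (intro mult_left_mono) auto
  finally show ?thesis by (simp add: SA_eq mult_ac)
qed

text \<open>
  Dropping the logarithms in \<open>influence_sum_ge_variance\<close> leaves a Poincare inequality for the total
  influence. As there are at most \<open>n\<^sup>2\<close> transpositions, Cauchy-Schwarz turns it into a bound free of
  \<open>n\<close>.
\<close>

lemma SqInf_ge: "(\<eta>\<^sup>2 / 2560)\<^sup>2 * (variance f)\<^sup>2 \<le> SqInf \<mu> U f"
proof -
  let ?c = "\<eta>\<^sup>2 / 2560"
  have "?c * variance f \<le> 1 / n * (\<Sum>u\<in>U. infl u / (1 + ln (1 / sqrt (infl u))))"
    by (rule influence_sum_ge_variance)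
  also have "\<dots> \<le> 1 / n * (\<Sum>u\<in>U. infl u)"
  proof (intro mult_left_mono sum_mono)
    fix u
    show "infl u / (1 + ln (1 / sqrt (infl u))) \<le> infl u"
    proof (cases "infl u = 0")
      case False
      then have p: "0 < sqrt (infl u)" "sqrt (infl u) \<le> 1" using infl_bounds[of u] by auto
      then have "0 \<le> ln (1 / sqrt (infl u))" by (intro ln_ge_zero) simp
      then show ?thesis using infl_bounds(1)[of u] by (simp add: field_simps)
    qed simp
  qed simp
  finally have "(?c * variance f)\<^sup>2 \<le> (1 / n * (\<Sum>u\<in>U. infl u))\<^sup>2"
    using variance_bounds by (intro power_mono) auto
  also have "\<dots> = (\<Sum>u\<in>U. infl u)\<^sup>2 / (real n)\<^sup>2" by (simp add: power_divide)
  also have "\<dots> \<le> SqInf \<mu> U f * card U / (real n)\<^sup>2"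
    using Cauchy_Schwarz_ineq_sum[of infl "\<lambda>_. 1" U]
    by (intro divide_right_mono) (auto simp: SqInf_def)
  also have "\<dots> \<le> SqInf \<mu> U f * (real n)\<^sup>2 / (real n)\<^sup>2"
    using card_transpositions_le[of n]
    by (intro divide_right_mono mult_left_mono) (auto simp: SqInf_def sum_nonneg simp flip: of_nat_power)
  also have "\<dots> = SqInf \<mu> U f" using n by simp
  finally show ?thesis by (simp only: power_mult_distrib)
qed

text \<open>
  By \<open>SqInf_ge\<close> the quantity \<open>1 + e / SqInf\<close> is at most a constant times \<open>z\<^sup>2\<close> with
  \<open>z = e / variance f\<close>, so its logarithm is at most a constant times \<open>ln z \<ge> 1\<close>.
\<close>

lemma eldan_gross:
  assumes v: "variance f \<noteq> 0"
  defines "K \<equiv> 2 + ln (1 + 1 / (\<eta>\<^sup>2 / 2560)\<^sup>2)"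
  shows "\<eta> / 384 / sqrt K * sqrt n * variance f * sqrt (ln (1 + exp 1 / SqInf \<mu> U f)) \<le> SA \<mu> U f"
proof -
  let ?v = "variance f"
  define a where "a = (\<eta>\<^sup>2 / 2560)\<^sup>2"
  define z where "z = exp 1 / ?v"
  have v0: "0 < ?v" "?v \<le> 1" using v variance_bounds by auto
  have a: "0 < a" using eta by (simp add: a_def)
  have K: "K = 2 + ln (1 + 1 / a)" "2 \<le> K" using a by (auto simp: K_def a_def)
  have lz: "ln z = 1 - ln ?v" using v0 by (simp add: z_def ln_div)
  moreover have "ln ?v \<le> 0" using v0 by simp
  ultimately have lz1: "1 \<le> ln z" by linarith
  have z1: "1 \<le> z" using v0 by (simp add: z_def) (smt (verit) exp_ge_add_one_self)
  have S: "a * ?v\<^sup>2 \<le> SqInf \<mu> U f" using SqInf_ge by (simp add: a_def)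
  then have S0: "0 < SqInf \<mu> U f" using a v0 by (smt (verit) mult_pos_pos zero_less_power)
  have "exp 1 / SqInf \<mu> U f \<le> exp 1 / (a * ?v\<^sup>2)"
    using S S0 a v0 by (intro divide_left_mono) auto
  also have "\<dots> \<le> z\<^sup>2 / a"
  proof -
    have "exp 1 * 1 \<le> exp 1 * (exp 1 :: real)" by (intro mult_left_mono) auto
    then have "exp 1 / (a * ?v\<^sup>2) \<le> exp 1 * exp 1 / (a * ?v\<^sup>2)" using a by (intro divide_right_mono) auto
    also have "\<dots> = z\<^sup>2 / a" by (simp add: z_def power_divide power2_eq_square mult_ac)
    finally show ?thesis .
  qed
  finally have "1 + exp 1 / SqInf \<mu> U f \<le> z\<^sup>2 * (1 + 1 / a)"
    using one_le_power[OF z1, of 2] by (simp add: distrib_left)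
  then have "ln (1 + exp 1 / SqInf \<mu> U f) \<le> ln (z\<^sup>2 * (1 + 1 / a))"
    using S0 by (intro ln_mono) (auto intro: add_pos_nonneg)
  also have "\<dots> = 2 * ln z + ln (1 + 1 / a)"
  proof -
    have "0 < z\<^sup>2" "0 < 1 + 1 / a" using z1 a by (auto intro: add_pos_pos)
    then show ?thesis using z1 by (simp add: ln_mult ln_realpow)
  qed
  also have "\<dots> \<le> K * ln z"
  proof -
    have "0 \<le> ln (1 + 1 / a)" using a by (intro ln_ge_zero) simp
    then have "ln (1 + 1 / a) * 1 \<le> ln (1 + 1 / a) * ln z" using lz1 by (intro mult_left_mono) auto
    then show ?thesis by (simp add: K(1) distrib_right)
  qed
  finally have "sqrt (ln (1 + exp 1 / SqInf \<mu> U f)) \<le> sqrt K * sqrt (ln z)"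
    by (simp add: real_sqrt_mult[symmetric])
  then have "\<eta> / 384 / sqrt K * sqrt n * ?v * sqrt (ln (1 + exp 1 / SqInf \<mu> U f))
      \<le> \<eta> / 384 / sqrt K * sqrt n * ?v * (sqrt K * sqrt (ln z))"
    using eta v0 K by (intro mult_left_mono) auto
  also have "\<dots> = \<eta> / 384 * sqrt n * ?v * sqrt (ln z)" using K by simp
  also have "\<dots> \<le> SA \<mu> U f" using surface_area_ge[OF v] by (simp add: z_def)
  finally show ?thesis .
qed

end

theorem theorem7p16:
  fixes \<eta> :: real
  assumes "0 < \<eta>" and "\<eta> \<le> 1 / 2"
  shows "\<exists>c::real. c > 0 \<and>
    (\<forall>(n::nat) (k::nat) (f :: nat set \<Rightarrow> real).
      n \<ge> 2 \<and> \<eta> \<le> real k / real n \<and> real k / real n \<le> 1 - \<eta> \<and> f \<in> slice n k \<rightarrow> {-1, 1} \<longrightarrow>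
      (let \<mu> = unif_slice n k; U = transpositions n in
        Max ((\<lambda>u. Infl \<mu> u f) ` U) \<ge> c * (ln (real n) / real n) * Varf \<mu> f
      \<and> c * Varf \<mu> f \<le>
          1 / real n * (\<Sum>u\<in>U. if Infl \<mu> u f = 0 then 0 else
            (pnorm \<mu> 2 (Ldiff u f))\<^sup>2 / (1 + ln (pnorm \<mu> 2 (Ldiff u f) / pnorm \<mu> 1 (Ldiff u f))))
      \<and> 1 / real n * (\<Sum>u\<in>U. if Infl \<mu> u f = 0 then 0 else
            (pnorm \<mu> 2 (Ldiff u f))\<^sup>2 / (1 + ln (pnorm \<mu> 2 (Ldiff u f) / pnorm \<mu> 1 (Ldiff u f))))
        = 1 / real n * (\<Sum>u\<in>U. if Infl \<mu> u f = 0 then 0 else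
            Infl \<mu> u f / (1 + ln (1 / sqrt (Infl \<mu> u f))))
      \<and> SA \<mu> U f \<ge> (if Varf \<mu> f = 0 then 0 else
            c * sqrt (real n) * Varf \<mu> f * sqrt (ln (exp 1 / Varf \<mu> f)))
      \<and> SA \<mu> U f \<ge> (if Varf \<mu> f = 0 then 0 else
            c * sqrt (real n) * Varf \<mu> f * sqrt (ln (1 + exp 1 / SqInf \<mu> U f)))))"
proof -
  define K where "K = 2 + ln (1 + 1 / (\<eta>\<^sup>2 / 2560)\<^sup>2)"
  define c where "c = min (min (\<eta> / 5120) (\<eta>\<^sup>2 / 2560)) (min (\<eta> / 384) (\<eta> / 384 / sqrt K))"
  have "0 \<le> ln (1 + 1 / (\<eta>\<^sup>2 / 2560)\<^sup>2)" by (intro ln_ge_zero) simp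
  then have "0 < K" unfolding K_def by linarith
  then have c0: "0 < c" using assms by (simp add: c_def)
  have c: "c \<le> \<eta> / 5120" "c \<le> \<eta>\<^sup>2 / 2560" "c \<le> \<eta> / 384" "c \<le> \<eta> / 384 / sqrt K"
    by (auto simp: c_def)
  have main: "Max ((\<lambda>u. Infl \<mu> u f) ` U) \<ge> c * (ln (real n) / real n) * Varf \<mu> f
      \<and> c * Varf \<mu> f \<le>
          1 / real n * (\<Sum>u\<in>U. if Infl \<mu> u f = 0 then 0 else
            (pnorm \<mu> 2 (Ldiff u f))\<^sup>2 / (1 + ln (pnorm \<mu> 2 (Ldiff u f) / pnorm \<mu> 1 (Ldiff u f))))
      \<and> 1 / real n * (\<Sum>u\<in>U. if Infl \<mu> u f = 0 then 0 else
            (pnorm \<mu> 2 (Ldiff u f))\<^sup>2 / (1 + ln (pnorm \<mu> 2 (Ldiff u f) / pnorm \<mu> 1 (Ldiff u f))))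
        = 1 / real n * (\<Sum>u\<in>U. if Infl \<mu> u f = 0 then 0 else
            Infl \<mu> u f / (1 + ln (1 / sqrt (Infl \<mu> u f))))
      \<and> SA \<mu> U f \<ge> (if Varf \<mu> f = 0 then 0 else
            c * sqrt (real n) * Varf \<mu> f * sqrt (ln (exp 1 / Varf \<mu> f)))
      \<and> SA \<mu> U f \<ge> (if Varf \<mu> f = 0 then 0 else
            c * sqrt (real n) * Varf \<mu> f * sqrt (ln (1 + exp 1 / SqInf \<mu> U f)))"
    if n: "2 \<le> n" and k: "\<eta> \<le> real k / real n" "real k / real n \<le> 1 - \<eta>"
      and f: "f \<in> slice n k \<rightarrow> {-1, 1}" and \<mu>: "\<mu> = unif_slice n k" and U: "U = transpositions n"
    for n k :: nat and f \<mu> U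
  proof -
    have "\<eta> * n \<le> k" "\<eta> * n \<le> real n - k" using n k by (simp_all add: field_simps)
    then interpret B: boolean_on_slice \<eta> n k f
      using assms n f by unfold_locales auto
    let ?inf = "\<lambda>u. Infl \<mu> u f" and ?v = "B.variance f"
    have v: "Varf \<mu> f = ?v" using B.Varf_eq by (simp add: \<mu>)
    note v0 = B.variance_bounds
    have terms: "(if ?inf u = 0 then 0 else
            (pnorm \<mu> 2 (Ldiff u f))\<^sup>2 / (1 + ln (pnorm \<mu> 2 (Ldiff u f) / pnorm \<mu> 1 (Ldiff u f))))
        = ?inf u / (1 + ln (1 / sqrt (?inf u)))"
      "(if ?inf u = 0 then 0 else ?inf u / (1 + ln (1 / sqrt (?inf u))))
        = ?inf u / (1 + ln (1 / sqrt (?inf u)))" if "u \<in> U" for u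
    proof -
      have u: "u \<in> transpositions n" using that by (simp add: U)
      have "sqrt (?inf u) / ?inf u = 1 / sqrt (?inf u)"
        using B.infl_bounds(1)[of u] by (simp add: \<mu> sqrt_divide_self_eq inverse_eq_divide)
      then show "(if ?inf u = 0 then 0 else
            (pnorm \<mu> 2 (Ldiff u f))\<^sup>2 / (1 + ln (pnorm \<mu> 2 (Ldiff u f) / pnorm \<mu> 1 (Ldiff u f))))
        = ?inf u / (1 + ln (1 / sqrt (?inf u)))"
        using B.pnorm_Ldiff[OF u] B.infl_bounds(1)[of u] by (simp add: \<mu>)
    qed simp
    have "c * (ln n / n) * ?v \<le> \<eta> / 5120 * (ln n / n) * ?v"
      using c(1) n v0 by (intro mult_right_mono) auto
    then have 1: "c * (ln n / n) * ?v \<le> Max (?inf ` U)"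
      unfolding \<mu> U by (rule order_trans[OF _ B.max_influence_ge])
    have "c * ?v \<le> \<eta>\<^sup>2 / 2560 * ?v" using c(2) v0 by (intro mult_right_mono)
    then have 2: "c * ?v \<le> 1 / n * (\<Sum>u\<in>U. ?inf u / (1 + ln (1 / sqrt (?inf u))))"
      unfolding \<mu> U by (rule order_trans[OF _ B.influence_sum_ge_variance])
    have SA0: "0 \<le> SA \<mu> U f" by (simp add: SA_def)
    have 3: "c * sqrt n * ?v * sqrt (ln (exp 1 / ?v)) \<le> SA \<mu> U f" if "?v \<noteq> 0"
    proof -
      have "ln ?v \<le> 0" using that v0 by simp
      moreover have "ln (exp 1 / ?v) = 1 - ln ?v" using that v0 by (simp add: ln_div)
      ultimately have "0 \<le> ln (exp 1 / ?v)" by linarith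
      then have "c * sqrt n * ?v * sqrt (ln (exp 1 / ?v)) \<le> \<eta> / 384 * sqrt n * ?v * sqrt (ln (exp 1 / ?v))"
        using c(3) v0 by (intro mult_right_mono) auto
      then show ?thesis unfolding \<mu> U by (rule order_trans[OF _ B.surface_area_ge[OF that]])
    qed
    have 4: "c * sqrt n * ?v * sqrt (ln (1 + exp 1 / SqInf \<mu> U f)) \<le> SA \<mu> U f" if "?v \<noteq> 0"
    proof -
      have "0 \<le> SqInf \<mu> U f" by (simp add: SqInf_def sum_nonneg)
      then have "0 \<le> ln (1 + exp 1 / SqInf \<mu> U f)" by (intro ln_ge_zero) simp
      then have "c * sqrt n * ?v * sqrt (ln (1 + exp 1 / SqInf \<mu> U f))
          \<le> \<eta> / 384 / sqrt K * sqrt n * ?v * sqrt (ln (1 + exp 1 / SqInf \<mu> U f))"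
        using c(4) v0 by (intro mult_right_mono) auto
      then show ?thesis unfolding \<mu> U K_def by (rule order_trans[OF _ B.eldan_gross[OF that]])
    qed
    show ?thesis
      unfolding v using 1 2 3 4 SA0 by (simp add: terms cong: sum.cong)
  qed
  show ?thesis
    unfolding Let_def by (intro exI[of _ c] conjI[OF c0] allI impI main[OF _ _ _ _ refl refl]) auto
qed

end
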